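(* Let $\mathcal A$ and $\mathcal X$ be cocomplete categories and let $T:\mathcal A\to\mathsf{Mnd}(\mathcal X)$ be a parametrized monad. Regard $\mathcal A\ltimes^T\mathcal X$ as the Eilenberg--Moore category of the monad $\hat T:(A,X)\mapsto(A,T_AX)$ on $\mathcal A\times\mathcal X$. Then, for all objects $a=(A,X,\xi)$ and $b=(B,Y,\theta)$ of $\mathcal A\ltimes^T\mathcal X$, the coequaliser appearing in Linton's computation of the binary coproduct of $a$ and $b$ happens in a single fibre, namely the one over the coproduct $A+B$ in $\mathcal A$: the objects of the reflexive pair lie over $A+B$, its two parallel arrows lie over the identity of $A+B$, and the coproduct is obtained as the coequaliser of this pair in the fibre $\mathsf{EM}(T_{A+B})$, whenever that coequaliser exists.
   Context: A parametrized monad is a functor $T:\mathcal A\to\mathsf{Mnd}(\mathcal X)$, $A\mapsto T_A$, into the category of monads on $\mathcal X$ and monad morphisms (natural transformations compatible with units and multiplications). $\mathcal A\ltimes^T\mathcal X$ has as objects triples $(A,X,\xi)$ with $\xi:T_AX\to X$ an Eilenberg--Moore algebra of $T_A$; morphisms $(A,X,\xi)\to(B,Y,\theta)$ are pairs $(f:A\to B,\ g:X\to Y)$ with $g\circ\xi=\theta\circ T(f,g)$. It is fibred over $\mathcal A$ by $(A,X,\xi)\mapsto A$, with fibre over $A$ the Eilenberg--Moore category $\mathsf{EM}(T_A)$, and it is isomorphic to $\mathsf{EM}(\hat T)$. **Linton's computation.** Let $U:\mathsf{EM}(\hat T)\to\mathcal A\times\mathcal X$ be the forgetful functor, $\Phi$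 its left adjoint and $\epsilon$ the counit. Coproducts of free algebras exist: $\Phi(u)*\Phi(v)\cong\Phi(u+v)$. The coproduct of two algebras $a,b$, when the relevant coequaliser exists, is the coequaliser of the reflexive pair $$\Phi U\Phi U(a)*\Phi U\Phi U(b)\ \rightrightarrows\ \Phi U(a)*\Phi U(b)$$ with parallel arrows $\epsilon_{\Phi U a}*\epsilon_{\Phi U b}$ and $\Phi U\epsilon_a*\Phi U\epsilon_b$, where $*$ denotes the coproduct of free algebras. *)

theory Defs
  imports "HOL-Library.FuncSet"
begin

section \<open>Categories and functors\<close>

record ('o, 'm) cat =
  Obj :: "'o set"
  Arr :: "'m set"
  Dom :: "'m \<Rightarrow> 'o"
  Cod :: "'m \<Rightarrow> 'o"
  Ident :: "'o \<Rightarrow> 'm"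
  Comp :: "'m \<Rightarrow> 'm \<Rightarrow> 'm"  (infixr "\<odot>\<index>" 70)

definition hom :: "('o, 'm) cat \<Rightarrow> 'o \<Rightarrow> 'o \<Rightarrow> 'm set" where
  "hom C x y = {f \<in> Arr C. Dom C f = x \<and> Cod C f = y}"

locale category =
  fixes C :: "('o, 'm) cat" (structure)
  assumes dom_in_Obj: "f \<in> Arr C \<Longrightarrow> Dom C f \<in> Obj C"
    and cod_in_Obj: "f \<in> Arr C \<Longrightarrow> Cod C f \<in> Obj C"
    and ident_in_hom: "x \<in> Obj C \<Longrightarrow> Ident C x \<in> hom C x x"
    and comp_in_hom: "\<lbrakk>f \<in> hom C x y; g \<in> hom C y z\<rbrakk> \<Longrightarrow> g \<odot> f \<in> hom C x z"
    and comp_ident: "f \<in> hom C x y \<Longrightarrow> f \<odot> Ident C x = f"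
    and ident_comp: "f \<in> hom C x y \<Longrightarrow> Ident C y \<odot> f = f"
    and comp_assoc: "\<lbrakk>f \<in> hom C w x; g \<in> hom C x y; h \<in> hom C y z\<rbrakk>
      \<Longrightarrow> (h \<odot> g) \<odot> f = h \<odot> (g \<odot> f)"

record ('o, 'm, 'p, 'n) fctr =
  FO :: "'o \<Rightarrow> 'p"
  FA :: "'m \<Rightarrow> 'n"

definition is_functor ::
    "('o, 'm) cat \<Rightarrow> ('p, 'n) cat \<Rightarrow> ('o, 'm, 'p, 'n) fctr \<Rightarrow> bool" where
  "is_functor C D F \<longleftrightarrow> category C \<and> category D \<and>
     (\<forall>x\<in>Obj C. FO F x \<in> Obj D) \<and>
     (\<forall>f\<in>Arr C. FA F f \<in> hom D (FO F (Dom C f)) (FO F (Cod C f))) \<and>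
     (\<forall>x\<in>Obj C. FA F (Ident C x) = Ident D (FO F x)) \<and>
     (\<forall>f\<in>Arr C. \<forall>g\<in>Arr C. Cod C f = Dom C g \<longrightarrow>
        FA F (g \<odot>\<^bsub>C\<^esub> f) = FA F g \<odot>\<^bsub>D\<^esub> FA F f)"

definition iso_functor ::
    "('o, 'm) cat \<Rightarrow> ('p, 'n) cat \<Rightarrow> ('o, 'm, 'p, 'n) fctr \<Rightarrow> bool" where
  "iso_functor C D F \<longleftrightarrow> is_functor C D F \<and>
     bij_betw (FO F) (Obj C) (Obj D) \<and> bij_betw (FA F) (Arr C) (Arr D)"

definition prod_cat :: "('o, 'm) cat \<Rightarrow> ('p, 'n) cat \<Rightarrow> ('o \<times> 'p, 'm \<times> 'n) cat" where
  "prod_cat C D =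
    \<lparr>Obj = Obj C \<times> Obj D, Arr = Arr C \<times> Arr D,
     Dom = (\<lambda>(f, g). (Dom C f, Dom D g)), Cod = (\<lambda>(f, g). (Cod C f, Cod D g)),
     Ident = (\<lambda>(x, y). (Ident C x, Ident D y)),
     Comp = (\<lambda>(f', g') (f, g). (f' \<odot>\<^bsub>C\<^esub> f, g' \<odot>\<^bsub>D\<^esub> g))\<rparr>"


section \<open>Colimits\<close>

definition is_cocone ::
    "('i, 'j) cat \<Rightarrow> ('o, 'm) cat \<Rightarrow> ('i, 'j, 'o, 'm) fctr \<Rightarrow> 'o \<Rightarrow> ('i \<Rightarrow> 'm) \<Rightarrow> bool" where
  "is_cocone J C D c \<kappa> \<longleftrightarrow> c \<in> Obj C \<and> (\<forall>i\<in>Obj J. \<kappa> i \<in> hom C (FO D i) c) \<and>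
     (\<forall>m\<in>Arr J. \<kappa> (Cod J m) \<odot>\<^bsub>C\<^esub> FA D m = \<kappa> (Dom J m))"

definition is_colimit ::
    "('i, 'j) cat \<Rightarrow> ('o, 'm) cat \<Rightarrow> ('i, 'j, 'o, 'm) fctr \<Rightarrow> 'o \<Rightarrow> ('i \<Rightarrow> 'm) \<Rightarrow> bool" where
  "is_colimit J C D c \<kappa> \<longleftrightarrow> is_cocone J C D c \<kappa> \<and>
     (\<forall>c' \<kappa>'. is_cocone J C D c' \<kappa>' \<longrightarrow>
        (\<exists>!h. h \<in> hom C c c' \<and> (\<forall>i\<in>Obj J. h \<odot>\<^bsub>C\<^esub> \<kappa> i = \<kappa>' i)))"

text \<open>
  Since HOL cannot quantify over all sets, smallness is relative to a type
  \<open>'u\<close>: a diagram is small if the objects and the arrows of its shape are elements of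
  \<open>'u\<close>. With \<open>'u\<close> infinite, every finite diagram is small up to isomorphism of its shape.
\<close>
definition cocomplete :: "'u itself \<Rightarrow> ('o, 'm) cat \<Rightarrow> bool" where
  "cocomplete _ C \<longleftrightarrow> category C \<and>
     (\<forall>(J :: ('u, 'u) cat) D. is_functor J C D \<longrightarrow> (\<exists>c \<kappa>. is_colimit J C D c \<kappa>))"

text \<open>A triple \<open>(s, i, j)\<close> below is a cospan \<open>i : x \<rightarrow> s \<leftarrow> y : j\<close>.\<close>

definition is_coproduct :: "('o, 'm) cat \<Rightarrow> 'o \<Rightarrow> 'o \<Rightarrow> 'o \<times> 'm \<times> 'm \<Rightarrow> bool" where
  "is_coproduct C x y = (\<lambda>(s, i, j).
     x \<in> Obj C \<and> y \<in> Obj C \<and> s \<in> Obj C \<and> i \<in> hom C x s \<and> j \<in> hom C y s \<and>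
     (\<forall>z f g. f \<in> hom C x z \<and> g \<in> hom C y z \<longrightarrow>
        (\<exists>!h. h \<in> hom C s z \<and> h \<odot>\<^bsub>C\<^esub> i = f \<and> h \<odot>\<^bsub>C\<^esub> j = g)))"

text \<open>The arrow \<open>f * g\<close> between two coproducts.\<close>
definition coprod_arrow ::
    "('o, 'm) cat \<Rightarrow> 'o \<times> 'm \<times> 'm \<Rightarrow> 'o \<times> 'm \<times> 'm \<Rightarrow> 'm \<Rightarrow> 'm \<Rightarrow> 'm" where
  "coprod_arrow C = (\<lambda>(s, i, j) (s', i', j') f g.
     THE h. h \<in> hom C s s' \<and> h \<odot>\<^bsub>C\<^esub> i = i' \<odot>\<^bsub>C\<^esub> f \<and> h \<odot>\<^bsub>C\<^esub> j = j' \<odot>\<^bsub>C\<^esub> g)"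

lemma cocomplete_coproduct:
  fixes C :: "('o, 'm) cat"
  assumes cc: "cocomplete TYPE('u) C" and inf: "infinite (UNIV :: 'u set)"
    and x: "x \<in> Obj C" and y: "y \<in> Obj C"
  shows "\<exists>k. is_coproduct C x y k"
proof -
  interpret category C using cc by (simp add: cocomplete_def)
  obtain u v :: 'u where uv: "u \<noteq> v"
    using inf by (metis (full_types) finite.simps infinite_arbitrarily_large UNIV_eq_I insertCI)
  define J :: "('u, 'u) cat" where
    "J = \<lparr>Obj = {u, v}, Arr = {u, v}, Dom = id, Cod = id, Ident = id, Comp = (\<lambda>g f. f)\<rparr>"
  define D where "D = \<lparr>FO = (\<lambda>i. if i = u then x else y),
    FA = (\<lambda>i. if i = u then Ident C x else Ident C y)\<rparr>"
  have J: "category J" by unfold_locales (auto simp: J_def hom_def)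
  have idc: "Ident C z \<odot>\<^bsub>C\<^esub> Ident C z = Ident C z" if "z \<in> Obj C" for z
    using that comp_ident ident_in_hom by blast
  have "is_functor J C D"
    using x y uv J ident_in_hom category_axioms
    by (auto simp: is_functor_def J_def D_def idc)
  then obtain c \<kappa> where c: "is_colimit J C D c \<kappa>"
    using cc unfolding cocomplete_def by blast
  have cone: "is_cocone J C D c' \<kappa>' \<longleftrightarrow>
      c' \<in> Obj C \<and> \<kappa>' u \<in> hom C x c' \<and> \<kappa>' v \<in> hom C y c'" for c' \<kappa>'
    using uv comp_ident by (auto simp: is_cocone_def J_def D_def)
  have "is_coproduct C x y (c, \<kappa> u, \<kappa> v)"
    unfolding is_coproduct_def prod.case
  proof (intro conjI allI impI)
    show "x \<in> Obj C" "y \<in> Obj C" by fact+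
    show "c \<in> Obj C" "\<kappa> u \<in> hom C x c" "\<kappa> v \<in> hom C y c"
      using c cone by (auto simp: is_colimit_def)
    fix z f g assume fg: "f \<in> hom C x z \<and> g \<in> hom C y z"
    then have "z \<in> Obj C" using cod_in_Obj by (auto simp: hom_def)
    then have "is_cocone J C D z (\<lambda>i. if i = u then f else g)" using fg uv cone by auto
    then have "\<exists>!h. h \<in> hom C c z \<and> (\<forall>i\<in>Obj J. h \<odot>\<^bsub>C\<^esub> \<kappa> i = (if i = u then f else g))"
      using c unfolding is_colimit_def by blast
    then show "\<exists>!h. h \<in> hom C c z \<and> h \<odot>\<^bsub>C\<^esub> \<kappa> u = f \<and> h \<odot>\<^bsub>C\<^esub> \<kappa> v = g"
      using uv by (simp add: J_def)
  qed
  then show ?thesis by blast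
qed

definition map_cospan ::
    "('o, 'm, 'p, 'n) fctr \<Rightarrow> 'o \<times> 'm \<times> 'm \<Rightarrow> 'p \<times> 'n \<times> 'n" where
  "map_cospan F = (\<lambda>(s, i, j). (FO F s, FA F i, FA F j))"

definition pair_cospan ::
    "'o \<times> 'm \<times> 'm \<Rightarrow> 'p \<times> 'n \<times> 'n \<Rightarrow> ('o \<times> 'p) \<times> ('m \<times> 'n) \<times> ('m \<times> 'n)" where
  "pair_cospan = (\<lambda>(s, i, j) (s', i', j'). ((s, s'), (i, i'), (j, j')))"

definition parallel :: "('o, 'm) cat \<Rightarrow> 'm \<Rightarrow> 'm \<Rightarrow> bool" where
  "parallel C f g \<longleftrightarrow> f \<in> Arr C \<and> g \<in> Arr C \<and> Dom C f = Dom C g \<and> Cod C f = Cod C g"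

definition reflexive_pair :: "('o, 'm) cat \<Rightarrow> 'm \<Rightarrow> 'm \<Rightarrow> bool" where
  "reflexive_pair C f g \<longleftrightarrow> parallel C f g \<and>
     (\<exists>r \<in> hom C (Cod C f) (Dom C f).
        f \<odot>\<^bsub>C\<^esub> r = Ident C (Cod C f) \<and> g \<odot>\<^bsub>C\<^esub> r = Ident C (Cod C f))"

definition is_coequaliser :: "('o, 'm) cat \<Rightarrow> 'm \<Rightarrow> 'm \<Rightarrow> 'o \<Rightarrow> 'm \<Rightarrow> bool" where
  "is_coequaliser C f g c q \<longleftrightarrow> parallel C f g \<and> q \<in> hom C (Cod C f) c \<and>
     q \<odot>\<^bsub>C\<^esub> f = q \<odot>\<^bsub>C\<^esub> g \<and>
     (\<forall>z k. k \<in> hom C (Cod C f) z \<and> k \<odot>\<^bsub>C\<^esub> f = k \<odot>\<^bsub>C\<^esub> g \<longrightarrow>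
        (\<exists>!h. h \<in> hom C c z \<and> h \<odot>\<^bsub>C\<^esub> q = k))"


section \<open>Monads and the category of monads\<close>

record ('o, 'm) monad =
  endo :: "('o, 'm, 'o, 'm) fctr"
  eta :: "'o \<Rightarrow> 'm"
  mu :: "'o \<Rightarrow> 'm"

abbreviation MO :: "('o, 'm) monad \<Rightarrow> 'o \<Rightarrow> 'o" where "MO M \<equiv> FO (endo M)"
abbreviation MA :: "('o, 'm) monad \<Rightarrow> 'm \<Rightarrow> 'm" where "MA M \<equiv> FA (endo M)"

definition is_monad :: "('o, 'm) cat \<Rightarrow> ('o, 'm) monad \<Rightarrow> bool" where
  "is_monad C M \<longleftrightarrow> is_functor C C (endo M) \<and>
     (\<forall>x\<in>Obj C. eta M x \<in> hom C x (MO M x)) \<and>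
     (\<forall>x\<in>Obj C. mu M x \<in> hom C (MO M (MO M x)) (MO M x)) \<and>
     (\<forall>f\<in>Arr C. eta M (Cod C f) \<odot>\<^bsub>C\<^esub> f = MA M f \<odot>\<^bsub>C\<^esub> eta M (Dom C f)) \<and>
     (\<forall>f\<in>Arr C. mu M (Cod C f) \<odot>\<^bsub>C\<^esub> MA M (MA M f) = MA M f \<odot>\<^bsub>C\<^esub> mu M (Dom C f)) \<and>
     (\<forall>x\<in>Obj C. mu M x \<odot>\<^bsub>C\<^esub> eta M (MO M x) = Ident C (MO M x)) \<and>
     (\<forall>x\<in>Obj C. mu M x \<odot>\<^bsub>C\<^esub> MA M (eta M x) = Ident C (MO M x)) \<and>
     (\<forall>x\<in>Obj C. mu M x \<odot>\<^bsub>C\<^esub> mu M (MO M x) = mu M x \<odot>\<^bsub>C\<^esub> MA M (mu M x))"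

text \<open>
  The components of a monad morphism are required to be extensional on the objects, so that
  equality of monad morphisms is equality of natural transformations.
\<close>
definition is_monad_morphism ::
    "('o, 'm) cat \<Rightarrow> ('o, 'm) monad \<Rightarrow> ('o, 'm) monad \<Rightarrow> ('o \<Rightarrow> 'm) \<Rightarrow> bool" where
  "is_monad_morphism C M N \<tau> \<longleftrightarrow> is_monad C M \<and> is_monad C N \<and>
     \<tau> \<in> (\<Pi>\<^sub>E x\<in>Obj C. hom C (MO M x) (MO N x)) \<and>
     (\<forall>f\<in>Arr C. \<tau> (Cod C f) \<odot>\<^bsub>C\<^esub> MA M f = MA N f \<odot>\<^bsub>C\<^esub> \<tau> (Dom C f)) \<and>
     (\<forall>x\<in>Obj C. \<tau> x \<odot>\<^bsub>C\<^esub> eta M x = eta N x) \<and>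
     (\<forall>x\<in>Obj C. \<tau> x \<odot>\<^bsub>C\<^esub> mu M x = mu N x \<odot>\<^bsub>C\<^esub> (\<tau> (MO N x) \<odot>\<^bsub>C\<^esub> MA M (\<tau> x)))"

type_synonym ('o, 'm) monad_mor = "('o, 'm) monad \<times> ('o, 'm) monad \<times> ('o \<Rightarrow> 'm)"

definition Mnd :: "('o, 'm) cat \<Rightarrow> (('o, 'm) monad, ('o, 'm) monad_mor) cat" where
  "Mnd C =
    \<lparr>Obj = {M. is_monad C M},
     Arr = {(M, N, \<tau>). is_monad_morphism C M N \<tau>},
     Dom = (\<lambda>(M, N, \<tau>). M), Cod = (\<lambda>(M, N, \<tau>). N),
     Ident = (\<lambda>M. (M, M, \<lambda>x\<in>Obj C. Ident C (MO M x))),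
     Comp = (\<lambda>(M', N', \<tau>') (M, N, \<tau>). (M, N', \<lambda>x\<in>Obj C. \<tau>' x \<odot>\<^bsub>C\<^esub> \<tau> x))\<rparr>"


section \<open>Eilenberg--Moore algebras and Linton's pair\<close>

text \<open>
  An arrow of \<open>EM C M\<close> is a triple consisting of its domain, its codomain and the
  underlying arrow of \<open>C\<close>.
\<close>
definition EM :: "('o, 'm) cat \<Rightarrow> ('o, 'm) monad
    \<Rightarrow> ('o \<times> 'm, ('o \<times> 'm) \<times> ('o \<times> 'm) \<times> 'm) cat" where
  "EM C M =
    (let Alg = {(x, \<xi>). x \<in> Obj C \<and> \<xi> \<in> hom C (MO M x) x \<and>
                  \<xi> \<odot>\<^bsub>C\<^esub> eta M x = Ident C x \<and>
                  \<xi> \<odot>\<^bsub>C\<^esub> mu M x = \<xi> \<odot>\<^bsub>C\<^esub> MA M \<xi>}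
     in \<lparr>Obj = Alg,
         Arr = {((x, \<xi>), (y, \<theta>), g). (x, \<xi>) \<in> Alg \<and> (y, \<theta>) \<in> Alg \<and> g \<in> hom C x y \<and>
                  g \<odot>\<^bsub>C\<^esub> \<xi> = \<theta> \<odot>\<^bsub>C\<^esub> MA M g},
         Dom = (\<lambda>(p, q, g). p), Cod = (\<lambda>(p, q, g). q),
         Ident = (\<lambda>p. (p, p, Ident C (fst p))),
         Comp = (\<lambda>(p', q', g') (p, q, g). (p, q', g' \<odot>\<^bsub>C\<^esub> g))\<rparr>)"

definition forget :: "('o \<times> 'm, ('o \<times> 'm) \<times> ('o \<times> 'm) \<times> 'm, 'o, 'm) fctr" where
  "forget = \<lparr>FO = (\<lambda>(x, \<xi>). x), FA = (\<lambda>(p, q, g). g)\<rparr>"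

definition free :: "('o, 'm) cat \<Rightarrow> ('o, 'm) monad
    \<Rightarrow> ('o, 'm, 'o \<times> 'm, ('o \<times> 'm) \<times> ('o \<times> 'm) \<times> 'm) fctr" where
  "free C M =
    \<lparr>FO = (\<lambda>x. (MO M x, mu M x)),
     FA = (\<lambda>f. ((MO M (Dom C f), mu M (Dom C f)), (MO M (Cod C f), mu M (Cod C f)), MA M f))\<rparr>"

definition counit :: "('o, 'm) cat \<Rightarrow> ('o, 'm) monad
    \<Rightarrow> 'o \<times> 'm \<Rightarrow> ('o \<times> 'm) \<times> ('o \<times> 'm) \<times> 'm" where
  "counit C M = (\<lambda>(x, \<xi>). (FO (free C M) x, (x, \<xi>), \<xi>))"

text \<open>
  Linton's two arrows \<open>\<Phi>U\<Phi>U a * \<Phi>U\<Phi>U b \<rightarrow> \<Phi>U a * \<Phi>U b\<close>, where \<open>\<Phi> u * \<Phi> v\<close> is \<open>\<Phi> (u + v)\<close>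
  with coprojections \<open>\<Phi> u \<rightarrow> \<Phi> (u + v) \<leftarrow> \<Phi> v\<close>. Here \<open>k\<close> is a coproduct cospan of \<open>U a\<close>
  and \<open>U b\<close>, and \<open>l\<close> is one of \<open>U\<Phi>U a\<close> and \<open>U\<Phi>U b\<close>. The first arrow is
  \<open>\<epsilon>\<^bsub>\<Phi>U a\<^esub> * \<epsilon>\<^bsub>\<Phi>U b\<^esub>\<close> and the second is \<open>\<Phi>U\<epsilon>\<^bsub>a\<^esub> * \<Phi>U\<epsilon>\<^bsub>b\<^esub>\<close>.
\<close>
definition linton_fst where
  "linton_fst C M k l a b =
    coprod_arrow (EM C M) (map_cospan (free C M) l) (map_cospan (free C M) k)
      (counit C M (FO (free C M) (FO forget a)))
      (counit C M (FO (free C M) (FO forget b)))"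

definition linton_snd where
  "linton_snd C M k l a b =
    coprod_arrow (EM C M) (map_cospan (free C M) l) (map_cospan (free C M) k)
      (FA (free C M) (FA forget (counit C M a)))
      (FA (free C M) (FA forget (counit C M b)))"


section \<open>Parametrized monads\<close>

type_synonym ('a, 'f, 'x, 'g) pmonad = "('a, 'f, ('x, 'g) monad, ('x, 'g) monad_mor) fctr"

definition parametrized_monad ::
    "('a, 'f) cat \<Rightarrow> ('x, 'g) cat \<Rightarrow> ('a, 'f, 'x, 'g) pmonad \<Rightarrow> bool" where
  "parametrized_monad A X T \<longleftrightarrow> is_functor A (Mnd X) T"

text \<open>For \<open>f : a \<rightarrow> b\<close> and \<open>g : x \<rightarrow> y\<close>, the arrow \<open>T (f, g) : T\<^sub>a x \<rightarrow> T\<^sub>b y\<close>.\<close>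
definition pm_arrow ::
    "('a, 'f) cat \<Rightarrow> ('x, 'g) cat \<Rightarrow> ('a, 'f, 'x, 'g) pmonad \<Rightarrow> 'f \<Rightarrow> 'g \<Rightarrow> 'g" where
  "pm_arrow A X T f g = (snd (snd (FA T f))) (Cod X g) \<odot>\<^bsub>X\<^esub> MA (FO T (Dom A f)) g"

definition hat :: "('a, 'f) cat \<Rightarrow> ('x, 'g) cat \<Rightarrow> ('a, 'f, 'x, 'g) pmonad
    \<Rightarrow> ('a \<times> 'x, 'f \<times> 'g) monad" where
  "hat A X T =
    \<lparr>endo = \<lparr>FO = (\<lambda>(a, x). (a, MO (FO T a) x)), FA = (\<lambda>(f, g). (f, pm_arrow A X T f g))\<rparr>,
     eta = (\<lambda>(a, x). (Ident A a, eta (FO T a) x)),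
     mu = (\<lambda>(a, x). (Ident A a, mu (FO T a) x))\<rparr>"

type_synonym ('a, 'x, 'g) pobj = "'a \<times> 'x \<times> 'g"
type_synonym ('a, 'f, 'x, 'g) parr = "('a, 'x, 'g) pobj \<times> ('a, 'x, 'g) pobj \<times> ('f \<times> 'g)"

definition semiprod :: "('a, 'f) cat \<Rightarrow> ('x, 'g) cat \<Rightarrow> ('a, 'f, 'x, 'g) pmonad
    \<Rightarrow> (('a, 'x, 'g) pobj, ('a, 'f, 'x, 'g) parr) cat" where
  "semiprod A X T =
    (let Tri = {(a, x, \<xi>). a \<in> Obj A \<and> (x, \<xi>) \<in> Obj (EM X (FO T a))}
     in \<lparr>Obj = Tri,
         Arr = {((a, x, \<xi>), (b, y, \<theta>), (f, g)). (a, x, \<xi>) \<in> Tri \<and> (b, y, \<theta>) \<in> Tri \<and>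
                  f \<in> hom A a b \<and> g \<in> hom X x y \<and>
                  g \<odot>\<^bsub>X\<^esub> \<xi> = \<theta> \<odot>\<^bsub>X\<^esub> pm_arrow A X T f g},
         Dom = (\<lambda>(p, q, fg). p), Cod = (\<lambda>(p, q, fg). q),
         Ident = (\<lambda>(a, x, \<xi>). ((a, x, \<xi>), (a, x, \<xi>), (Ident A a, Ident X x))),
         Comp = (\<lambda>(p', q', (f', g')) (p, q, (f, g)). (p, q', (f' \<odot>\<^bsub>A\<^esub> f, g' \<odot>\<^bsub>X\<^esub> g)))\<rparr>)"

definition semiprod_proj :: "(('a, 'x, 'g) pobj, ('a, 'f, 'x, 'g) parr, 'a, 'f) fctr" where
  "semiprod_proj = \<lparr>FO = (\<lambda>(a, x, \<xi>). a), FA = (\<lambda>(p, q, (f, g)). f)\<rparr>"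

text \<open>
  The inclusion of \<open>EM X (FO T a)\<close> as the fibre over \<open>a\<close>: the objects lying over \<open>a\<close> and the
  arrows lying over the identity of \<open>a\<close>.
\<close>
definition fibre_incl :: "('a, 'f) cat \<Rightarrow> 'a
    \<Rightarrow> ('x \<times> 'g, ('x \<times> 'g) \<times> ('x \<times> 'g) \<times> 'g,
        ('a, 'x, 'g) pobj, ('a, 'f, 'x, 'g) parr) fctr" where
  "fibre_incl A a =
    \<lparr>FO = (\<lambda>(x, \<xi>). (a, x, \<xi>)), FA = (\<lambda>(p, q, g). ((a, p), (a, q), (Ident A a, g)))\<rparr>"

text \<open>
  The identification of \<open>semiprod A X T\<close> with the Eilenberg--Moore category of \<open>hat A X T\<close>. The unit
  law forces the \<open>A\<close>-component of the structure map of a \<open>hat A X T\<close>-algebra to be an identity.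
\<close>
definition to_EM_hat :: "('a, 'f) cat
    \<Rightarrow> (('a, 'x, 'g) pobj, ('a, 'f, 'x, 'g) parr,
        ('a \<times> 'x) \<times> ('f \<times> 'g),
        (('a \<times> 'x) \<times> ('f \<times> 'g)) \<times> (('a \<times> 'x) \<times> ('f \<times> 'g)) \<times> ('f \<times> 'g)) fctr" where
  "to_EM_hat A =
    (let K = (\<lambda>(a, x, \<xi>). ((a, x), (Ident A a, \<xi>)))
     in \<lparr>FO = K, FA = (\<lambda>(p, q, fg). (K p, K q, fg))\<rparr>)"

end

theory Submission
  imports Defs
begin

text \<open>
  Write \<open>\<Phi>\<close> for the free algebra functor, \<open>U\<close> for the forgetful functor and \<open>\<epsilon>\<close> for the counit
  of a monad.

  That Linton's coequaliser is a coproduct is an instance of colimits commuting with colimits.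
  Every algebra \<open>a\<close> is the coequaliser, with \<open>\<epsilon>\<^bsub>a\<^esub>\<close> as quotient map, of its canonical pair
  \<open>\<epsilon>\<^bsub>\<Phi>Ua\<^esub>, \<Phi>U\<epsilon>\<^bsub>a\<^esub> : \<Phi>U\<Phi>U a \<rightarrow> \<Phi>U a\<close> (\<open>counit_coequaliser\<close>), coproducts of free algebras are computed
  by \<open>\<Phi>\<close> (\<open>free_coproduct\<close>), and a coequaliser of a coproduct of two pairs is a coproduct of their
  coequalisers (\<open>coproduct_of_coequalisers\<close>). This gives \<open>linton_coproduct\<close> for every monad on
  every category, for the coproducts and coequalisers that exist, and it is transported to \<open>\<A> \<ltimes> \<X>\<close> along the isomorphism with the
  Eilenberg--Moore category of the monad \<open>(a, x) \<mapsto> (a, T\<^sub>a x)\<close>.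

  The pair lives in one fibre because this monad is the identity in the first variable. Unit,
  multiplication and, by the unit law, all structure maps have identities as first components,
  so restricting one of Linton's arrows along a coprojection gives an arrow that lies over the
  coprojection of \<open>A + B\<close>. An endomorphism of \<open>A + B\<close> that fixes both coprojections is the
  identity (\<open>vertical_of_coprojections\<close>).

  It remains to compare coequalisers of a vertical pair in the fibre with those in the total
  category, and this uses only that \<open>\<A> \<ltimes> \<X> \<rightarrow> \<A>\<close> is a fibration: an algebra is reindexed along
  \<open>u\<close> by precomposing its structure map with the monad morphism \<open>T\<^sub>u\<close>. Arrows over \<open>u\<close> out of the
  fibre are then arrows of the fibre into a reindexed object, so a coequaliser in the
  fibre has the universal property against all arrows (\<open>fibre_coequaliser_preserve\<close>).
  Conversely, let \<open>q\<close> be a coequaliser of the vertical pair in the total category, and factor it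
  as \<open>q = d \<circ> p\<close> with \<open>d\<close> cartesian and \<open>p\<close> vertical. Then \<open>p\<close> also coequalises the pair, so
  \<open>p = h \<circ> q\<close> for some \<open>h\<close>; the arrows \<open>h\<close> and \<open>d\<close> are mutually inverse, and hence \<open>p\<close> is a
  coequaliser in the fibre (\<open>fibre_coequaliser_exists\<close>).
\<close>

section \<open>Coproducts, coequalisers and isomorphisms of categories\<close>

lemma homI: "f \<in> Arr C \<Longrightarrow> Dom C f = x \<Longrightarrow> Cod C f = y \<Longrightarrow> f \<in> hom C x y"
  by (simp add: hom_def)

lemma homD:
  assumes "f \<in> hom C x y"
  shows "f \<in> Arr C" "Dom C f = x" "Cod C f = y"
  using assms by (simp_all add: hom_def)

context category
begin

lemma hom_Obj:
  assumes "f \<in> hom C x y"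
  shows "x \<in> Obj C" "y \<in> Obj C"
  using assms dom_in_Obj cod_in_Obj by (auto simp: hom_def)

lemma Ident_Arr:
  assumes "x \<in> Obj C"
  shows "Ident C x \<in> Arr C" "Dom C (Ident C x) = x" "Cod C (Ident C x) = x"
  using ident_in_hom[OF assms] by (auto simp: hom_def)

lemma assoc:
  "\<lbrakk>f \<in> Arr C; g \<in> Arr C; h \<in> Arr C; Cod C f = Dom C g; Cod C g = Dom C h\<rbrakk>
    \<Longrightarrow> (h \<odot> g) \<odot> f = h \<odot> (g \<odot> f)"
  by (rule comp_assoc) (auto simp: hom_def)

lemma coproduct_homs:
  assumes "is_coproduct C x y (s, i, j)"
  shows "i \<in> hom C x s" "j \<in> hom C y s"
  using assms by (auto simp: is_coproduct_def)

lemma coproduct_universal: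
  assumes c: "is_coproduct C x y (s, i, j)" and f: "f \<in> hom C x z" and g: "g \<in> hom C y z"
  shows "\<exists>!h. h \<in> hom C s z \<and> h \<odot> i = f \<and> h \<odot> j = g"
proof -
  have "\<forall>z f g. f \<in> hom C x z \<and> g \<in> hom C y z \<longrightarrow>
      (\<exists>!h. h \<in> hom C s z \<and> h \<odot> i = f \<and> h \<odot> j = g)"
    using c by (simp add: is_coproduct_def)
  from this[rule_format, OF conjI[OF f g]] show ?thesis .
qed

lemma copair_exists:
  assumes "is_coproduct C x y (s, i, j)" "f \<in> hom C x z" "g \<in> hom C y z"
  obtains h where "h \<in> hom C s z" "h \<odot> i = f" "h \<odot> j = g"
  using coproduct_universal[OF assms] that by blast

lemma coproduct_ext:
  assumes c: "is_coproduct C x y (s, i, j)" and "h \<in> hom C s z" "h' \<in> hom C s z"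
    and "h \<odot> i = h' \<odot> i" "h \<odot> j = h' \<odot> j"
  shows "h = h'"
proof -
  have "h \<odot> i \<in> hom C x z" "h \<odot> j \<in> hom C y z"
    using comp_in_hom[OF coproduct_homs(1)[OF c] assms(2)]
      comp_in_hom[OF coproduct_homs(2)[OF c] assms(2)] by simp_all
  from coproduct_universal[OF c this]
  have "\<exists>\<^sub>\<le>\<^sub>1h'. h' \<in> hom C s z \<and> h' \<odot> i = h \<odot> i \<and> h' \<odot> j = h \<odot> j"
    by (simp add: ex1_iff_ex_Uniq)
  then show ?thesis by (rule Uniq_D) (use assms in simp_all)
qed

lemma coprod_arrow:
  assumes s: "is_coproduct C x y (s, i, j)" and s': "is_coproduct C x' y' (s', i', j')"
    and f: "f \<in> hom C x x'" and g: "g \<in> hom C y y'"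
  defines "h \<equiv> coprod_arrow C (s, i, j) (s', i', j') f g"
  shows "h \<in> hom C s s'" "h \<odot> i = i' \<odot> f" "h \<odot> j = j' \<odot> g"
proof -
  have "i' \<odot> f \<in> hom C x s'" "j' \<odot> g \<in> hom C y s'"
    using comp_in_hom[OF f coproduct_homs(1)[OF s']] comp_in_hom[OF g coproduct_homs(2)[OF s']]
    by simp_all
  then have "\<exists>!h. h \<in> hom C s s' \<and> h \<odot> i = i' \<odot> f \<and> h \<odot> j = j' \<odot> g"
    by (rule coproduct_universal[OF s])
  from theI'[OF this] show "h \<in> hom C s s'" "h \<odot> i = i' \<odot> f" "h \<odot> j = j' \<odot> g"
    by (auto simp: h_def coprod_arrow_def)
qed

text \<open>
  The operation \<open>f * g\<close> is functorial, so sections of \<open>f\<close> and of \<open>g\<close> combine to one of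
  \<open>f * g\<close>. Since the resulting section depends only on those of \<open>f\<close> and \<open>g\<close>, a coproduct of
  reflexive pairs is reflexive.
\<close>
lemma coprod_arrow_split_epi:
  assumes s: "is_coproduct C x y (s, i, j)" and s': "is_coproduct C x' y' (s', i', j')"
    and f: "f \<in> hom C x x'" and g: "g \<in> hom C y y'"
    and r: "r \<in> hom C x' x" "f \<odot> r = Ident C x'"
    and t: "t \<in> hom C y' y" "g \<odot> t = Ident C y'"
  shows "coprod_arrow C (s, i, j) (s', i', j') f g
    \<odot> coprod_arrow C (s', i', j') (s, i, j) r t = Ident C s'"
proof (rule coproduct_ext[OF s'])
  let ?h = "coprod_arrow C (s, i, j) (s', i', j') f g"
  let ?k = "coprod_arrow C (s', i', j') (s, i, j) r t"
  note h = coprod_arrow[OF s s' f g] and k = coprod_arrow[OF s' s r(1) t(1)]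
  note a = h(1) k(1) f g r(1) t(1) coproduct_homs[OF s] coproduct_homs[OF s']
  show "?h \<odot> ?k \<in> hom C s' s'" by (rule comp_in_hom[OF a(2,1)])
  show "Ident C s' \<in> hom C s' s'" by (rule ident_in_hom[OF hom_Obj(2)[OF a(1)]])
  have "(?h \<odot> ?k) \<odot> i' = ?h \<odot> (i \<odot> r)"
    using comp_assoc[OF a(9,2,1)] k(2) by simp
  also have "\<dots> = i' \<odot> (f \<odot> r)"
    using comp_assoc[OF a(5,7,1)] comp_assoc[OF a(5,3,9)] h(2) by simp
  finally show "(?h \<odot> ?k) \<odot> i' = Ident C s' \<odot> i'"
    using r(2) comp_ident[OF a(9)] ident_comp[OF a(9)] by simp
  have "(?h \<odot> ?k) \<odot> j' = ?h \<odot> (j \<odot> t)"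
    using comp_assoc[OF a(10,2,1)] k(3) by simp
  also have "\<dots> = j' \<odot> (g \<odot> t)"
    using comp_assoc[OF a(6,8,1)] comp_assoc[OF a(6,4,10)] h(3) by simp
  finally show "(?h \<odot> ?k) \<odot> j' = Ident C s' \<odot> j'"
    using t(2) comp_ident[OF a(10)] ident_comp[OF a(10)] by simp
qed

lemma coequaliser_hom:
  assumes "is_coequaliser C f g c q" "f \<in> hom C x y"
  shows "q \<in> hom C y c"
  using assms by (auto simp: is_coequaliser_def hom_def)

lemma coequaliser_eq: "is_coequaliser C f g c q \<Longrightarrow> q \<odot> f = q \<odot> g"
  by (simp add: is_coequaliser_def)

lemma coequaliser_universal:
  assumes c: "is_coequaliser C f g c q" and k: "k \<in> hom C (Cod C f) z" "k \<odot> f = k \<odot> g"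
  shows "\<exists>!h. h \<in> hom C c z \<and> h \<odot> q = k"
proof -
  have "\<forall>z k. k \<in> hom C (Cod C f) z \<and> k \<odot> f = k \<odot> g \<longrightarrow>
      (\<exists>!h. h \<in> hom C c z \<and> h \<odot> q = k)"
    using c by (simp add: is_coequaliser_def)
  from this[rule_format, OF conjI[OF k]] show ?thesis .
qed

lemma coequaliser_desc:
  assumes "is_coequaliser C f g c q" "f \<in> hom C x y" "k \<in> hom C y z" "k \<odot> f = k \<odot> g"
  obtains h where "h \<in> hom C c z" "h \<odot> q = k"
proof -
  have "k \<in> hom C (Cod C f) z" using assms homD by metis
  from coequaliser_universal[OF assms(1) this assms(4)] show ?thesis using that by blast
qed

lemma coequaliser_ext:
  assumes c: "is_coequaliser C f g c q"
    and h: "h \<in> hom C c z" "h' \<in> hom C c z" "h \<odot> q = h' \<odot> q"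
  shows "h = h'"
proof -
  have p: "f \<in> Arr C" "g \<in> Arr C" "Dom C f = Dom C g" "Cod C f = Cod C g"
    and q: "q \<in> hom C (Cod C f) c" and e: "q \<odot> f = q \<odot> g"
    using c by (auto simp: is_coequaliser_def parallel_def)
  have "h \<odot> q \<in> hom C (Cod C f) z" by (rule comp_in_hom[OF q h(1)])
  moreover have "(h \<odot> q) \<odot> f = (h \<odot> q) \<odot> g"
    using p q e h by (simp add: hom_def assoc)
  ultimately have "\<exists>\<^sub>\<le>\<^sub>1h'. h' \<in> hom C c z \<and> h' \<odot> q = h \<odot> q"
    using coequaliser_universal[OF c] by (simp add: ex1_iff_ex_Uniq)
  then show ?thesis by (rule Uniq_D) (use h in simp_all)
qed

text \<open>
  An arrow \<open>k\<close> out of \<open>s\<close> coequalises \<open>f1 * f2\<close> and \<open>g1 * g2\<close> if and only if \<open>k \<odot> i\<close> coequalises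
  \<open>f1, g1\<close> and \<open>k \<odot> j\<close> coequalises \<open>f2, g2\<close>. Thus both \<open>c\<close> and a coproduct of \<open>a\<close> and \<open>b\<close>
  represent pairs of arrows out of \<open>x\<close> and \<open>y\<close> that coequalise the respective pairs.
\<close>
lemma coproduct_of_coequalisers:
  assumes f1: "f1 \<in> hom C x' x" and g1: "g1 \<in> hom C x' x"
    and f2: "f2 \<in> hom C y' y" and g2: "g2 \<in> hom C y' y"
    and p1: "is_coequaliser C f1 g1 a p1" and p2: "is_coequaliser C f2 g2 b p2"
    and t: "is_coproduct C x' y' (t, i', j')" and s: "is_coproduct C x y (s, i, j)"
    and q: "is_coequaliser C (coprod_arrow C (t, i', j') (s, i, j) f1 f2)
      (coprod_arrow C (t, i', j') (s, i, j) g1 g2) c q"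
  shows "\<exists>m n. is_coproduct C a b (c, m, n) \<and> m \<odot> p1 = q \<odot> i \<and> n \<odot> p2 = q \<odot> j"
proof -
  let ?f = "coprod_arrow C (t, i', j') (s, i, j) f1 f2"
  let ?g = "coprod_arrow C (t, i', j') (s, i, j) g1 g2"
  note f = coprod_arrow[OF t s f1 f2] and g = coprod_arrow[OF t s g1 g2]
  note ij = coproduct_homs[OF s] and ij' = coproduct_homs[OF t]
  note pq = coequaliser_hom[OF p1 f1] coequaliser_hom[OF p2 f2] coequaliser_hom[OF q f(1)]
  have precomp: "k \<odot> ?f = k \<odot> ?g \<longleftrightarrow>
      (k \<odot> i) \<odot> f1 = (k \<odot> i) \<odot> g1 \<and> (k \<odot> j) \<odot> f2 = (k \<odot> j) \<odot> g2"
    if k: "k \<in> hom C s z" for k z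
  proof -
    have "k \<odot> ?f \<in> hom C t z" "k \<odot> ?g \<in> hom C t z" by (rule comp_in_hom[OF f(1) k] comp_in_hom[OF g(1) k])+
    then have "k \<odot> ?f = k \<odot> ?g \<longleftrightarrow>
        (k \<odot> ?f) \<odot> i' = (k \<odot> ?g) \<odot> i' \<and> (k \<odot> ?f) \<odot> j' = (k \<odot> ?g) \<odot> j'"
      using coproduct_ext[OF t] by metis
    moreover have "(k \<odot> ?f) \<odot> i' = (k \<odot> i) \<odot> f1" "(k \<odot> ?g) \<odot> i' = (k \<odot> i) \<odot> g1"
      "(k \<odot> ?f) \<odot> j' = (k \<odot> j) \<odot> f2" "(k \<odot> ?g) \<odot> j' = (k \<odot> j) \<odot> g2"
      using f(2,3) g(2,3) comp_assoc[OF ij'(1) f(1) k] comp_assoc[OF ij'(1) g(1) k]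
        comp_assoc[OF ij'(2) f(1) k] comp_assoc[OF ij'(2) g(1) k]
        comp_assoc[OF f1 ij(1) k] comp_assoc[OF g1 ij(1) k]
        comp_assoc[OF f2 ij(2) k] comp_assoc[OF g2 ij(2) k] by simp_all
    ultimately show ?thesis by simp
  qed
  have qij: "(q \<odot> i) \<odot> f1 = (q \<odot> i) \<odot> g1" "(q \<odot> j) \<odot> f2 = (q \<odot> j) \<odot> g2"
    using precomp[OF pq(3)] coequaliser_eq[OF q] by auto
  have qi: "q \<odot> i \<in> hom C x c" "q \<odot> j \<in> hom C y c" by (rule comp_in_hom[OF ij(1) pq(3)] comp_in_hom[OF ij(2) pq(3)])+
  obtain m where m: "m \<in> hom C a c" "m \<odot> p1 = q \<odot> i"
    using coequaliser_desc[OF p1 f1 qi(1) qij(1)] by blast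
  obtain n where n: "n \<in> hom C b c" "n \<odot> p2 = q \<odot> j"
    using coequaliser_desc[OF p2 f2 qi(2) qij(2)] by blast
  have "is_coproduct C a b (c, m, n)"
    unfolding is_coproduct_def prod.case
  proof (intro conjI allI impI)
    show "a \<in> Obj C" "b \<in> Obj C" "c \<in> Obj C" "m \<in> hom C a c" "n \<in> hom C b c"
      using m n hom_Obj[OF m(1)] hom_Obj[OF n(1)] by simp_all
    fix z u v assume "u \<in> hom C a z \<and> v \<in> hom C b z"
    then have u: "u \<in> hom C a z" and v: "v \<in> hom C b z" by auto
    have "u \<odot> p1 \<in> hom C x z" "v \<odot> p2 \<in> hom C y z" by (rule comp_in_hom[OF pq(1) u] comp_in_hom[OF pq(2) v])+
    then obtain k where k: "k \<in> hom C s z" "k \<odot> i = u \<odot> p1" "k \<odot> j = v \<odot> p2"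
      using copair_exists[OF s] by metis
    have "(u \<odot> p1) \<odot> f1 = (u \<odot> p1) \<odot> g1" "(v \<odot> p2) \<odot> f2 = (v \<odot> p2) \<odot> g2"
      using coequaliser_eq[OF p1] coequaliser_eq[OF p2]
        comp_assoc[OF f1 pq(1) u] comp_assoc[OF g1 pq(1) u]
        comp_assoc[OF f2 pq(2) v] comp_assoc[OF g2 pq(2) v] by simp_all
    then have "k \<odot> ?f = k \<odot> ?g" using precomp[OF k(1)] k by simp
    then obtain h where h: "h \<in> hom C c z" "h \<odot> q = k"
      using coequaliser_desc[OF q f(1) k(1)] by blast
    have "(h \<odot> m) \<odot> p1 = u \<odot> p1" "(h \<odot> n) \<odot> p2 = v \<odot> p2"
      using comp_assoc[OF pq(1) m(1) h(1)] comp_assoc[OF ij(1) pq(3) h(1)]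
        comp_assoc[OF pq(2) n(1) h(1)] comp_assoc[OF ij(2) pq(3) h(1)] h k m n by simp_all
    moreover have "h \<odot> m \<in> hom C a z" "h \<odot> n \<in> hom C b z" by (rule comp_in_hom[OF m(1) h(1)] comp_in_hom[OF n(1) h(1)])+
    ultimately have "h \<odot> m = u" "h \<odot> n = v"
      using coequaliser_ext[OF p1 _ u] coequaliser_ext[OF p2 _ v] by blast+
    moreover have "h' = h" if h': "h' \<in> hom C c z" "h' \<odot> m = u" "h' \<odot> n = v" for h'
    proof (rule coequaliser_ext[OF q h'(1) h(1)])
      have "(h' \<odot> q) \<odot> i = k \<odot> i" "(h' \<odot> q) \<odot> j = k \<odot> j"
        using comp_assoc[OF pq(1) m(1) h'(1)] comp_assoc[OF ij(1) pq(3) h'(1)]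
          comp_assoc[OF pq(2) n(1) h'(1)] comp_assoc[OF ij(2) pq(3) h'(1)] h' k m n by simp_all
      moreover have "h' \<odot> q \<in> hom C s z" by (rule comp_in_hom[OF pq(3) h'(1)])
      ultimately show "h' \<odot> q = h \<odot> q" using coproduct_ext[OF s _ k(1)] h(2) by blast
    qed
    ultimately show "\<exists>!h. h \<in> hom C c z \<and> h \<odot> m = u \<and> h \<odot> n = v" using h(1) by blast
  qed
  then show ?thesis using m n by blast
qed

end

lemma functor_hom: "is_functor C D F \<Longrightarrow> f \<in> hom C x y \<Longrightarrow> FA F f \<in> hom D (FO F x) (FO F y)"
  by (auto simp: is_functor_def hom_def)

lemma functor_Obj: "is_functor C D F \<Longrightarrow> x \<in> Obj C \<Longrightarrow> FO F x \<in> Obj D"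
  by (auto simp: is_functor_def)

lemma functor_comp:
  "is_functor C D F \<Longrightarrow> f \<in> hom C x y \<Longrightarrow> g \<in> hom C y z
    \<Longrightarrow> FA F (g \<odot>\<^bsub>C\<^esub> f) = FA F g \<odot>\<^bsub>D\<^esub> FA F f"
  by (auto simp: is_functor_def hom_def)

lemma functor_Ident: "is_functor C D F \<Longrightarrow> x \<in> Obj C \<Longrightarrow> FA F (Ident C x) = Ident D (FO F x)"
  by (auto simp: is_functor_def)

text \<open>
  The transport results below are stated in the directions in which they are used: Linton's pair
  and the coproduct are found in the Eilenberg--Moore category \<open>D\<close> and brought back to \<open>C\<close>,
  whereas the coequaliser is given in \<open>C\<close>.
\<close>
locale category_iso =
  fixes C :: "('o, 'm) cat" and D :: "('p, 'n) cat" and F :: "('o, 'm, 'p, 'n) fctr"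
  assumes iso: "iso_functor C D F"
begin

lemma F: "is_functor C D F" and bij_Obj: "bij_betw (FO F) (Obj C) (Obj D)"
  and bij_Arr: "bij_betw (FA F) (Arr C) (Arr D)"
  using iso by (auto simp: iso_functor_def)

sublocale C: category C using F by (simp add: is_functor_def)
sublocale D: category D using F by (simp add: is_functor_def)

lemma FO_inj: "x \<in> Obj C \<Longrightarrow> y \<in> Obj C \<Longrightarrow> FO F x = FO F y \<Longrightarrow> x = y"
  using bij_Obj by (auto simp: bij_betw_def inj_on_def)

lemma FA_inj: "f \<in> Arr C \<Longrightarrow> g \<in> Arr C \<Longrightarrow> FA F f = FA F g \<longleftrightarrow> f = g"
  using bij_Arr by (auto simp: bij_betw_def inj_on_def)

lemma Obj_lift:
  assumes "y \<in> Obj D" obtains x where "x \<in> Obj C" "FO F x = y"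
proof -
  have "y \<in> FO F ` Obj C" using assms bij_Obj by (simp add: bij_betw_def)
  then show ?thesis using that by blast
qed

lemma hom_lift:
  assumes "h \<in> hom D (FO F x) (FO F y)" "x \<in> Obj C" "y \<in> Obj C"
  obtains f where "f \<in> hom C x y" "FA F f = h"
proof -
  have "h \<in> FA F ` Arr C" using homD(1)[OF assms(1)] bij_Arr by (simp add: bij_betw_def)
  then obtain f where f: "f \<in> Arr C" "FA F f = h" by blast
  then have "FA F f \<in> hom D (FO F (Dom C f)) (FO F (Cod C f))"
    by (intro functor_hom[OF F]) (simp add: hom_def)
  then have "FO F (Dom C f) = FO F x" "FO F (Cod C f) = FO F y"
    using f assms by (auto simp: hom_def)
  then have "Dom C f = x" "Cod C f = y"
    using FO_inj C.dom_in_Obj[OF f(1)] C.cod_in_Obj[OF f(1)] assms by simp_all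
  then show ?thesis using that[OF homI] f by simp
qed

lemma reflexive_pair_reflect:
  assumes f: "f \<in> hom C x y" and g: "g \<in> hom C x y" and r: "reflexive_pair D (FA F f) (FA F g)"
  shows "reflexive_pair C f g"
proof -
  have x: "x \<in> Obj C" "y \<in> Obj C" using C.hom_Obj[OF f] by simp_all
  note ff = homD[OF functor_hom[OF F f]]
  obtain r where r: "r \<in> hom D (FO F y) (FO F x)" "FA F f \<odot>\<^bsub>D\<^esub> r = Ident D (FO F y)"
      "FA F g \<odot>\<^bsub>D\<^esub> r = Ident D (FO F y)"
    using r ff by (auto simp: reflexive_pair_def)
  obtain s where s: "s \<in> hom C y x" "FA F s = r" using hom_lift[OF r(1)] x by blast
  have "FA F (f \<odot>\<^bsub>C\<^esub> s) = FA F (Ident C y)" "FA F (g \<odot>\<^bsub>C\<^esub> s) = FA F (Ident C y)"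
    using functor_comp[OF F s(1)] f g s r functor_Ident[OF F x(2)] by auto
  moreover have "f \<odot>\<^bsub>C\<^esub> s \<in> Arr C" "g \<odot>\<^bsub>C\<^esub> s \<in> Arr C" "Ident C y \<in> Arr C"
    using homD(1)[OF C.comp_in_hom[OF s(1) f]] homD(1)[OF C.comp_in_hom[OF s(1) g]] C.Ident_Arr[OF x(2)]
    by simp_all
  ultimately have "f \<odot>\<^bsub>C\<^esub> s = Ident C y" "g \<odot>\<^bsub>C\<^esub> s = Ident C y" using FA_inj by blast+
  then show ?thesis using s f g by (auto simp: reflexive_pair_def parallel_def hom_def)
qed

lemma coequaliser_preserve:
  assumes q: "is_coequaliser C f g c q"
  shows "is_coequaliser D (FA F f) (FA F g) (FO F c) (FA F q)"
proof -
  obtain x y where f: "f \<in> hom C x y" and g: "g \<in> hom C x y"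
    using q by (auto simp: is_coequaliser_def parallel_def hom_def)
  note qh = C.coequaliser_hom[OF q f]
  note x = C.hom_Obj[OF f] and c = C.hom_Obj(2)[OF qh]
  note ff = functor_hom[OF F f] and gg = functor_hom[OF F g] and qq = functor_hom[OF F qh]
  show ?thesis unfolding is_coequaliser_def homD(3)[OF ff]
  proof (intro conjI allI impI)
    show "parallel D (FA F f) (FA F g)" using ff gg by (simp add: parallel_def hom_def)
    show "FA F q \<in> hom D (FO F y) (FO F c)" by (rule qq)
    show "FA F q \<odot>\<^bsub>D\<^esub> FA F f = FA F q \<odot>\<^bsub>D\<^esub> FA F g"
      using functor_comp[OF F _ qh] f g C.coequaliser_eq[OF q] by metis
    fix z' k' assume k': "k' \<in> hom D (FO F y) z' \<and> k' \<odot>\<^bsub>D\<^esub> FA F f = k' \<odot>\<^bsub>D\<^esub> FA F g"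
    then obtain z where z: "z \<in> Obj C" "FO F z = z'" using Obj_lift D.hom_Obj by metis
    then obtain k where k: "k \<in> hom C y z" "FA F k = k'" using hom_lift k' x by metis
    have "FA F (k \<odot>\<^bsub>C\<^esub> f) = FA F (k \<odot>\<^bsub>C\<^esub> g)"
      using functor_comp[OF F _ k(1)] f g k k' by metis
    then have "k \<odot>\<^bsub>C\<^esub> f = k \<odot>\<^bsub>C\<^esub> g"
      using FA_inj[OF homD(1)[OF C.comp_in_hom[OF f k(1)]] homD(1)[OF C.comp_in_hom[OF g k(1)]]] by simp
    then obtain h where h: "h \<in> hom C c z" "h \<odot>\<^bsub>C\<^esub> q = k"
      using C.coequaliser_desc[OF q f k(1)] by blast
    show "\<exists>!h. h \<in> hom D (FO F c) z' \<and> h \<odot>\<^bsub>D\<^esub> FA F q = k'"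
    proof (rule ex1I[of _ "FA F h"])
      show "FA F h \<in> hom D (FO F c) z' \<and> FA F h \<odot>\<^bsub>D\<^esub> FA F q = k'"
        using functor_hom[OF F h(1)] functor_comp[OF F qh h(1)] h k z by simp
      fix h' assume h': "h' \<in> hom D (FO F c) z' \<and> h' \<odot>\<^bsub>D\<^esub> FA F q = k'"
      then obtain h1 where h1: "h1 \<in> hom C c z" "FA F h1 = h'" using hom_lift c z by metis
      then have "FA F (h1 \<odot>\<^bsub>C\<^esub> q) = FA F k" using functor_comp[OF F qh h1(1)] h' k by simp
      then have "h1 \<odot>\<^bsub>C\<^esub> q = k" using FA_inj[OF homD(1)[OF C.comp_in_hom[OF qh h1(1)]] homD(1)[OF k(1)]] by simp
      then show "h' = FA F h" using C.coequaliser_ext[OF q h1(1) h(1)] h h1 by simp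
    qed
  qed
qed

lemma coproduct_reflect:
  assumes x: "x \<in> Obj C" "y \<in> Obj C" and c: "c \<in> Obj C"
    and p: "is_coproduct D (FO F x) (FO F y) (FO F c, m', n')"
  obtains m n where "m \<in> hom C x c" "n \<in> hom C y c" "FA F m = m'" "FA F n = n'"
    "is_coproduct C x y (c, m, n)"
proof -
  obtain m where m: "m \<in> hom C x c" "FA F m = m'"
    using hom_lift[OF D.coproduct_homs(1)[OF p] x(1) c] by blast
  obtain n where n: "n \<in> hom C y c" "FA F n = n'"
    using hom_lift[OF D.coproduct_homs(2)[OF p] x(2) c] by blast
  have "is_coproduct C x y (c, m, n)"
    unfolding is_coproduct_def prod.case
  proof (intro conjI allI impI)
    fix z f g assume fg: "f \<in> hom C x z \<and> g \<in> hom C y z"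
    then have z: "z \<in> Obj C" using C.hom_Obj by blast
    have "FA F f \<in> hom D (FO F x) (FO F z)" "FA F g \<in> hom D (FO F y) (FO F z)"
      using fg functor_hom[OF F] by blast+
    then obtain h' where h': "h' \<in> hom D (FO F c) (FO F z)"
      "h' \<odot>\<^bsub>D\<^esub> m' = FA F f" "h' \<odot>\<^bsub>D\<^esub> n' = FA F g"
      using D.copair_exists[OF p] by metis
    have char: "h \<odot>\<^bsub>C\<^esub> m = f \<longleftrightarrow> FA F h \<odot>\<^bsub>D\<^esub> m' = FA F f"
      "h \<odot>\<^bsub>C\<^esub> n = g \<longleftrightarrow> FA F h \<odot>\<^bsub>D\<^esub> n' = FA F g" if "h \<in> hom C c z" for h
      using functor_comp[OF F m(1) that] functor_comp[OF F n(1) that] m n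
        FA_inj[OF homD(1)[OF C.comp_in_hom[OF m(1) that]] homD(1)[OF conjunct1[OF fg]]]
        FA_inj[OF homD(1)[OF C.comp_in_hom[OF n(1) that]] homD(1)[OF conjunct2[OF fg]]]
      by simp_all
    obtain h where h: "h \<in> hom C c z" "FA F h = h'" using hom_lift[OF h'(1) c z] by blast
    show "\<exists>!h. h \<in> hom C c z \<and> h \<odot>\<^bsub>C\<^esub> m = f \<and> h \<odot>\<^bsub>C\<^esub> n = g"
    proof (rule ex1I[of _ h])
      show "h \<in> hom C c z \<and> h \<odot>\<^bsub>C\<^esub> m = f \<and> h \<odot>\<^bsub>C\<^esub> n = g" using char h h' by simp
      fix h1 assume h1: "h1 \<in> hom C c z \<and> h1 \<odot>\<^bsub>C\<^esub> m = f \<and> h1 \<odot>\<^bsub>C\<^esub> n = g"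
      then have "FA F h1 = h'"
        using D.coproduct_ext[OF p functor_hom[OF F, of h1 c z] h'(1)] char h' by auto
      then show "h1 = h" using h h1 FA_inj homD(1) by metis
    qed
  qed (use x c m n in auto)
  then show ?thesis using that m n by blast
qed

end

section \<open>Eilenberg--Moore categories and Linton's computation\<close>

lemma EM_Obj: "(x, \<xi>) \<in> Obj (EM C M) \<longleftrightarrow> x \<in> Obj C \<and> \<xi> \<in> hom C (MO M x) x \<and>
    \<xi> \<odot>\<^bsub>C\<^esub> eta M x = Ident C x \<and> \<xi> \<odot>\<^bsub>C\<^esub> mu M x = \<xi> \<odot>\<^bsub>C\<^esub> MA M \<xi>"
  by (simp add: EM_def)

lemma EM_Arr: "((x, \<xi>), (y, \<theta>), g) \<in> Arr (EM C M) \<longleftrightarrow>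
    (x, \<xi>) \<in> Obj (EM C M) \<and> (y, \<theta>) \<in> Obj (EM C M) \<and> g \<in> hom C x y \<and>
    g \<odot>\<^bsub>C\<^esub> \<xi> = \<theta> \<odot>\<^bsub>C\<^esub> MA M g"
  by (simp add: EM_def)

lemma EM_simps [simp]:
  "Dom (EM C M) (p, q, g) = p" "Cod (EM C M) (p, q, g) = q"
  "Ident (EM C M) p = (p, p, Ident C (fst p))"
  "(p', q', g') \<odot>\<^bsub>EM C M\<^esub> (p, q, g) = (p, q', g' \<odot>\<^bsub>C\<^esub> g)"
  by (simp_all add: EM_def)

lemma EM_hom: "h \<in> hom (EM C M) p q \<longleftrightarrow> (\<exists>g. h = (p, q, g) \<and> h \<in> Arr (EM C M))"
  by (cases h) (auto simp: hom_def)

lemma EM_homE: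
  assumes "h \<in> hom (EM C M) (x, \<xi>) (y, \<theta>)"
  obtains g where "h = ((x, \<xi>), (y, \<theta>), g)" "(x, \<xi>) \<in> Obj (EM C M)" "(y, \<theta>) \<in> Obj (EM C M)"
    "g \<in> hom C x y" "g \<odot>\<^bsub>C\<^esub> \<xi> = \<theta> \<odot>\<^bsub>C\<^esub> MA M g"
  using assms by (auto simp: EM_hom EM_Arr)

lemma EM_homI:
  assumes "(x, \<xi>) \<in> Obj (EM C M)" "(y, \<theta>) \<in> Obj (EM C M)" "g \<in> hom C x y"
    "g \<odot>\<^bsub>C\<^esub> \<xi> = \<theta> \<odot>\<^bsub>C\<^esub> MA M g"
  shows "((x, \<xi>), (y, \<theta>), g) \<in> hom (EM C M) (x, \<xi>) (y, \<theta>)"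
  using assms by (simp add: EM_hom EM_Arr)

locale monad_on = category C for C :: "('o, 'm) cat" (structure) +
  fixes M :: "('o, 'm) monad"
  assumes monad: "is_monad C M"
begin

lemma endo: "is_functor C C (endo M)" using monad by (simp add: is_monad_def)

lemmas MA_hom = functor_hom[OF endo] and MO_Obj = functor_Obj[OF endo]
  and MA_comp = functor_comp[OF endo] and MA_Ident = functor_Ident[OF endo]

lemma eta_hom: "x \<in> Obj C \<Longrightarrow> eta M x \<in> hom C x (MO M x)"
  and mu_hom: "x \<in> Obj C \<Longrightarrow> mu M x \<in> hom C (MO M (MO M x)) (MO M x)"
  and mu_eta: "x \<in> Obj C \<Longrightarrow> mu M x \<odot> eta M (MO M x) = Ident C (MO M x)"
  and mu_MA_eta: "x \<in> Obj C \<Longrightarrow> mu M x \<odot> MA M (eta M x) = Ident C (MO M x)"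
  and mu_mu: "x \<in> Obj C \<Longrightarrow> mu M x \<odot> mu M (MO M x) = mu M x \<odot> MA M (mu M x)"
  using monad by (simp_all add: is_monad_def)

lemma eta_nat: "f \<in> hom C x y \<Longrightarrow> eta M y \<odot> f = MA M f \<odot> eta M x"
  and mu_nat: "f \<in> hom C x y \<Longrightarrow> mu M y \<odot> MA M (MA M f) = MA M f \<odot> mu M x"
  using monad by (auto simp: is_monad_def hom_def)

lemma EM_category: "category (EM C M)"
proof
  let ?E = "EM C M"
  fix f assume "f \<in> Arr ?E"
  then show "Dom ?E f \<in> Obj ?E" "Cod ?E f \<in> Obj ?E" by (auto simp: EM_def Let_def)
next
  let ?E = "EM C M"
  fix p assume "p \<in> Obj ?E"
  then obtain x \<xi> where p: "p = (x, \<xi>)" "(x, \<xi>) \<in> Obj ?E" by (cases p) auto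
  then show "Ident ?E p \<in> hom ?E p p"
    by (auto simp: EM_hom EM_Arr EM_Obj ident_in_hom MA_Ident comp_ident ident_comp)
next
  let ?E = "EM C M"
  fix f p q g r assume f: "f \<in> hom ?E p q" and g: "g \<in> hom ?E q r"
  obtain x \<xi> y \<theta> z \<zeta> where p: "p = (x, \<xi>)" "q = (y, \<theta>)" "r = (z, \<zeta>)" by (metis surj_pair)
  obtain f' where f': "f = (p, q, f')" "p \<in> Obj ?E" "q \<in> Obj ?E" "f' \<in> hom C x y"
    "f' \<odot> \<xi> = \<theta> \<odot> MA M f'" using f p by (auto elim: EM_homE)
  obtain g' where g': "g = (q, r, g')" "r \<in> Obj ?E" "g' \<in> hom C y z"
    "g' \<odot> \<theta> = \<zeta> \<odot> MA M g'" using g p by (auto elim: EM_homE)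
  have h: "\<xi> \<in> hom C (MO M x) x" "\<theta> \<in> hom C (MO M y) y" "\<zeta> \<in> hom C (MO M z) z"
    using f' g' p by (auto simp: EM_Obj)
  have "(g' \<odot> f') \<odot> \<xi> = g' \<odot> (\<theta> \<odot> MA M f')" using comp_assoc[OF h(1) f'(4) g'(3)] f' by simp
  also have "\<dots> = (\<zeta> \<odot> MA M g') \<odot> MA M f'"
    using comp_assoc[OF MA_hom[OF f'(4)] h(2) g'(3)] g' by simp
  also have "\<dots> = \<zeta> \<odot> MA M (g' \<odot> f')"
    using comp_assoc[OF MA_hom[OF f'(4)] MA_hom[OF g'(3)] h(3)] MA_comp[OF f'(4) g'(3)] by simp
  finally show "g \<odot>\<^bsub>?E\<^esub> f \<in> hom ?E p r"
    using f' g' p comp_in_hom[OF f'(4) g'(3)] by (auto intro!: EM_homI)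
next
  let ?E = "EM C M"
  fix f p q assume "f \<in> hom ?E p q"
  moreover obtain x \<xi> y \<theta> where "p = (x, \<xi>)" "q = (y, \<theta>)" by (metis surj_pair)
  ultimately obtain g where "f = (p, q, g)" "g \<in> hom C (fst p) (fst q)" by (auto elim: EM_homE)
  then show "f \<odot>\<^bsub>?E\<^esub> Ident ?E p = f" "Ident ?E q \<odot>\<^bsub>?E\<^esub> f = f"
    by (simp_all add: comp_ident ident_comp)
next
  let ?E = "EM C M"
  fix f g h p q r s assume f: "f \<in> hom ?E p q" and g: "g \<in> hom ?E q r" and h: "h \<in> hom ?E r s"
  obtain x \<xi> y \<theta> z \<zeta> w \<omega> where "p = (x, \<xi>)" "q = (y, \<theta>)" "r = (z, \<zeta>)" "s = (w, \<omega>)"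
    by (metis surj_pair)
  then obtain f' g' h' where "f = (p, q, f')" "g = (q, r, g')" "h = (r, s, h')"
    "f' \<in> hom C x y" "g' \<in> hom C y z" "h' \<in> hom C z w"
    using f g h by (auto elim!: EM_homE)
  then show "(h \<odot>\<^bsub>?E\<^esub> g) \<odot>\<^bsub>?E\<^esub> f = h \<odot>\<^bsub>?E\<^esub> (g \<odot>\<^bsub>?E\<^esub> f)"
    by (simp add: comp_assoc)
qed

sublocale EM: category "EM C M" by (rule EM_category)

lemma free_Obj: "x \<in> Obj C \<Longrightarrow> (MO M x, mu M x) \<in> Obj (EM C M)"
  by (simp add: EM_Obj MO_Obj mu_hom mu_eta mu_mu)

lemma free_hom:
  assumes "f \<in> hom C x y"
  shows "FA (free C M) f \<in> hom (EM C M) (MO M x, mu M x) (MO M y, mu M y)"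
  using assms homD[OF assms] hom_Obj[OF assms]
  by (auto simp: free_def free_Obj MA_hom mu_nat intro!: EM_homI)

lemma free_FA: "f \<in> hom C x y \<Longrightarrow> FA (free C M) f = ((MO M x, mu M x), (MO M y, mu M y), MA M f)"
  by (auto simp: free_def hom_def)

lemma free_comp:
  assumes "f \<in> hom C x y" "g \<in> hom C y z"
  shows "FA (free C M) (g \<odot> f) = FA (free C M) g \<odot>\<^bsub>EM C M\<^esub> FA (free C M) f"
  using assms comp_in_hom[OF assms] by (simp add: free_FA MA_comp)

lemma free_Ident: "x \<in> Obj C \<Longrightarrow> FA (free C M) (Ident C x) = Ident (EM C M) (MO M x, mu M x)"
  using free_FA[OF ident_in_hom] by (simp add: MA_Ident)

lemma counit_hom:
  assumes "(x, \<xi>) \<in> Obj (EM C M)"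
  shows "counit C M (x, \<xi>) \<in> hom (EM C M) (MO M x, mu M x) (x, \<xi>)"
  using assms free_Obj by (auto simp: counit_def free_def EM_Obj intro!: EM_homI)

text \<open>
  Here and in the next two lemmas: \<open>f \<mapsto> \<zeta> \<odot> MA M f\<close> and \<open>g \<mapsto> g \<odot> eta M x\<close> are the mutually
  inverse transpositions between arrows \<open>x \<rightarrow> z\<close> and algebra morphisms from the free algebra on
  \<open>x\<close> to \<open>(z, \<zeta>)\<close>.
\<close>
lemma transpose_eta:
  assumes a: "(z, \<zeta>) \<in> Obj (EM C M)" and f: "f \<in> hom C x z"
  shows "(\<zeta> \<odot> MA M f) \<odot> eta M x = f"
proof -
  have z: "\<zeta> \<in> hom C (MO M z) z" "\<zeta> \<odot> eta M z = Ident C z" using a by (auto simp: EM_Obj)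
  note x = hom_Obj[OF f]
  have "(\<zeta> \<odot> MA M f) \<odot> eta M x = \<zeta> \<odot> (eta M z \<odot> f)"
    using comp_assoc[OF eta_hom[OF x(1)] MA_hom[OF f] z(1)] eta_nat[OF f] by simp
  also have "\<dots> = f" using comp_assoc[OF f eta_hom[OF x(2)] z(1)] z f ident_comp by simp
  finally show ?thesis .
qed

lemma transpose_hom:
  assumes a: "(z, \<zeta>) \<in> Obj (EM C M)" and f: "f \<in> hom C x z"
  shows "((MO M x, mu M x), (z, \<zeta>), \<zeta> \<odot> MA M f) \<in> hom (EM C M) (MO M x, mu M x) (z, \<zeta>)"
  using EM.comp_in_hom[OF free_hom[OF f] counit_hom[OF a]] f
  by (simp add: free_FA counit_def)

lemma free_hom_transpose:
  assumes g: "((MO M x, mu M x), (z, \<zeta>), g) \<in> hom (EM C M) (MO M x, mu M x) (z, \<zeta>)"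
    and x: "x \<in> Obj C"
  shows "g \<odot> eta M x \<in> hom C x z" "\<zeta> \<odot> MA M (g \<odot> eta M x) = g"
proof -
  have g': "g \<in> hom C (MO M x) z" "g \<odot> mu M x = \<zeta> \<odot> MA M g" and z: "\<zeta> \<in> hom C (MO M z) z"
    using g by (auto elim!: EM_homE simp: EM_Obj)
  note e = eta_hom[OF x]
  show "g \<odot> eta M x \<in> hom C x z" by (rule comp_in_hom[OF e g'(1)])
  have "\<zeta> \<odot> MA M (g \<odot> eta M x) = (g \<odot> mu M x) \<odot> MA M (eta M x)"
    using MA_comp[OF e g'(1)] comp_assoc[OF MA_hom[OF e] MA_hom[OF g'(1)] z] g' by simp
  also have "\<dots> = g"
    using comp_assoc[OF MA_hom[OF e] mu_hom[OF x] g'(1)] mu_MA_eta[OF x] comp_ident[OF g'(1)]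
    by simp
  finally show "\<zeta> \<odot> MA M (g \<odot> eta M x) = g" .
qed

text \<open>
  The free functor is a left adjoint: transposition turns a cocone of algebra morphisms under
  the free algebras on \<open>x\<close> and \<open>y\<close> into a cocone under \<open>x\<close> and \<open>y\<close>, which is copaired in \<open>C\<close>.
\<close>
lemma free_coproduct:
  assumes k: "is_coproduct C x y k"
  shows "is_coproduct (EM C M) (MO M x, mu M x) (MO M y, mu M y) (map_cospan (free C M) k)"
proof -
  obtain s i j where kk: "k = (s, i, j)" by (cases k)
  note k = k[unfolded kk]
  let ?E = "EM C M" and ?F = "FA (free C M)"
  note ij = coproduct_homs[OF k]
  have o: "x \<in> Obj C" "y \<in> Obj C" "s \<in> Obj C" using hom_Obj[OF ij(1)] hom_Obj[OF ij(2)] by simp_all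
  have "is_coproduct ?E (MO M x, mu M x) (MO M y, mu M y) ((MO M s, mu M s), ?F i, ?F j)"
    unfolding is_coproduct_def prod.case
  proof (intro conjI allI impI)
    fix p f g
    assume fg: "f \<in> hom ?E (MO M x, mu M x) p \<and> g \<in> hom ?E (MO M y, mu M y) p"
    obtain z \<zeta> where p: "p = (z, \<zeta>)" by (cases p)
    obtain f' where f: "f = ((MO M x, mu M x), (z, \<zeta>), f')" and z: "(z, \<zeta>) \<in> Obj ?E"
      using fg p by (auto elim: EM_homE)
    obtain g' where g: "g = ((MO M y, mu M y), (z, \<zeta>), g')"
      using fg p by (auto elim: EM_homE)
    have z': "\<zeta> \<in> hom C (MO M z) z" using z by (simp add: EM_Obj)
    note f' = free_hom_transpose[of x z \<zeta> f'] and g' = free_hom_transpose[of y z \<zeta> g']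
    have f': "f' \<odot> eta M x \<in> hom C x z" "\<zeta> \<odot> MA M (f' \<odot> eta M x) = f'"
      using f' o fg f p by auto
    have g': "g' \<odot> eta M y \<in> hom C y z" "\<zeta> \<odot> MA M (g' \<odot> eta M y) = g'"
      using g' o fg g p by auto
    have restr: "h \<odot>\<^bsub>?E\<^esub> ?F u = ((MO M v, mu M v), (z, \<zeta>), \<zeta> \<odot> MA M (h0 \<odot> u))"
      if "h = ((MO M s, mu M s), (z, \<zeta>), \<zeta> \<odot> MA M h0)" "h0 \<in> hom C s z" "u \<in> hom C v s" for h h0 u v
      using that comp_assoc[OF MA_hom[OF that(3)] MA_hom[OF that(2)] z']
      by (simp add: free_FA MA_comp)
    obtain h0 where h0: "h0 \<in> hom C s z" "h0 \<odot> i = f' \<odot> eta M x" "h0 \<odot> j = g' \<odot> eta M y"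
      using copair_exists[OF k f'(1) g'(1)] by blast
    define h where "h = ((MO M s, mu M s), (z, \<zeta>), \<zeta> \<odot> MA M h0)"
    have h: "h \<in> hom ?E (MO M s, mu M s) p"
      using transpose_hom[OF z h0(1)] p by (simp add: h_def)
    show "\<exists>!h. h \<in> hom ?E (MO M s, mu M s) p \<and> h \<odot>\<^bsub>?E\<^esub> ?F i = f \<and> h \<odot>\<^bsub>?E\<^esub> ?F j = g"
    proof (rule ex1I[of _ h])
      show "h \<in> hom ?E (MO M s, mu M s) p \<and> h \<odot>\<^bsub>?E\<^esub> ?F i = f \<and> h \<odot>\<^bsub>?E\<^esub> ?F j = g"
        using h restr[OF h_def h0(1)] ij h0 f' g' f g by simp
      fix r assume r: "r \<in> hom ?E (MO M s, mu M s) p \<and> r \<odot>\<^bsub>?E\<^esub> ?F i = f \<and> r \<odot>\<^bsub>?E\<^esub> ?F j = g"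
      then obtain r' where r': "r = ((MO M s, mu M s), (z, \<zeta>), r')"
        using p by (auto elim: EM_homE)
      have t: "r' \<odot> eta M s \<in> hom C s z" "\<zeta> \<odot> MA M (r' \<odot> eta M s) = r'"
        using free_hom_transpose[of s z \<zeta> r'] r r' p o by auto
      have "((MO M x, mu M x), (z, \<zeta>), \<zeta> \<odot> MA M ((r' \<odot> eta M s) \<odot> i)) = f"
        "((MO M y, mu M y), (z, \<zeta>), \<zeta> \<odot> MA M ((r' \<odot> eta M s) \<odot> j)) = g"
        using restr[OF _ t(1)] ij r r' t by auto
      then have e: "\<zeta> \<odot> MA M ((r' \<odot> eta M s) \<odot> i) = f'" "\<zeta> \<odot> MA M ((r' \<odot> eta M s) \<odot> j) = g'"
        using f g by auto
      have "(r' \<odot> eta M s) \<odot> i = h0 \<odot> i" "(r' \<odot> eta M s) \<odot> j = h0 \<odot> j"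
        using transpose_eta[OF z comp_in_hom[OF ij(1) t(1)]]
          transpose_eta[OF z comp_in_hom[OF ij(2) t(1)]] e h0 by auto
      then have "r' \<odot> eta M s = h0" by (rule coproduct_ext[OF k t(1) h0(1)])
      then show "r = h" using t r' by (simp add: h_def)
    qed
  qed (use o ij free_Obj free_hom in auto)
  then show ?thesis by (simp add: map_cospan_def kk free_def)
qed

text \<open>
  The only candidate for the factorisation of \<open>k\<close> through \<open>\<xi>\<close> is \<open>k \<odot> eta M x\<close>, because \<open>eta M x\<close>
  is a section of \<open>\<xi>\<close> in \<open>C\<close>. It is in general not a section in \<open>EM C M\<close>, so that the candidate
  is an algebra morphism has to be deduced from \<open>k\<close> coequalising the pair: this gives
  \<open>(k \<odot> eta M x) \<odot> \<xi> = k\<close>.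
\<close>
lemma counit_coequaliser:
  assumes a: "(x, \<xi>) \<in> Obj (EM C M)"
  shows "is_coequaliser (EM C M) (counit C M (MO M x, mu M x)) (FA (free C M) \<xi>)
    (x, \<xi>) (counit C M (x, \<xi>))"
proof -
  let ?E = "EM C M"
  have x: "x \<in> Obj C" "\<xi> \<in> hom C (MO M x) x" "\<xi> \<odot> eta M x = Ident C x"
    "\<xi> \<odot> mu M x = \<xi> \<odot> MA M \<xi>" using a by (auto simp: EM_Obj)
  note x1 = MO_Obj[OF x(1)]
  note f = counit_hom[OF free_Obj[OF x(1)]] and g = free_hom[OF x(2)] and c = counit_hom[OF a]
  show ?thesis unfolding is_coequaliser_def homD(3)[OF f]
  proof (intro conjI allI impI)
    show "parallel ?E (counit C M (MO M x, mu M x)) (FA (free C M) \<xi>)"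
      using homD[OF f] homD[OF g] by (simp add: parallel_def)
    show "counit C M (x, \<xi>) \<in> hom ?E (MO M x, mu M x) (x, \<xi>)" by (rule c)
    show "counit C M (x, \<xi>) \<odot>\<^bsub>?E\<^esub> counit C M (MO M x, mu M x)
      = counit C M (x, \<xi>) \<odot>\<^bsub>?E\<^esub> FA (free C M) \<xi>"
      using x by (simp add: counit_def free_FA) (simp add: free_def)
    fix p k
    assume k: "k \<in> hom ?E (MO M x, mu M x) p \<and>
      k \<odot>\<^bsub>?E\<^esub> counit C M (MO M x, mu M x) = k \<odot>\<^bsub>?E\<^esub> FA (free C M) \<xi>"
    obtain z \<zeta> where p: "p = (z, \<zeta>)" by (cases p)
    obtain k' where k': "k = ((MO M x, mu M x), (z, \<zeta>), k')" "k' \<in> hom C (MO M x) z"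
      and z: "(z, \<zeta>) \<in> Obj ?E" using k p by (auto elim: EM_homE)
    have km: "k' \<odot> mu M x = k' \<odot> MA M \<xi>"
      using k k' x by (simp add: counit_def free_FA)
    note t = free_hom_transpose[of x z \<zeta> k']
    have t: "k' \<odot> eta M x \<in> hom C x z" "\<zeta> \<odot> MA M (k' \<odot> eta M x) = k'"
      using t k k' p x by auto
    have "(k' \<odot> eta M x) \<odot> \<xi> = k' \<odot> (MA M \<xi> \<odot> eta M (MO M x))"
      using comp_assoc[OF x(2) eta_hom[OF x(1)] k'(2)] eta_nat[OF x(2)] by simp
    also have "\<dots> = k' \<odot> (mu M x \<odot> eta M (MO M x))"
      using comp_assoc[OF eta_hom[OF x1] MA_hom[OF x(2)] k'(2)]
        comp_assoc[OF eta_hom[OF x1] mu_hom[OF x(1)] k'(2)] km by simp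
    also have "\<dots> = k'" using mu_eta[OF x(1)] comp_ident[OF k'(2)] by simp
    finally have e: "(k' \<odot> eta M x) \<odot> \<xi> = k'" .
    define h where "h = ((x, \<xi>), (z, \<zeta>), k' \<odot> eta M x)"
    show "\<exists>!h. h \<in> hom ?E (x, \<xi>) p \<and> h \<odot>\<^bsub>?E\<^esub> counit C M (x, \<xi>) = k"
    proof (rule ex1I[of _ h])
      show "h \<in> hom ?E (x, \<xi>) p \<and> h \<odot>\<^bsub>?E\<^esub> counit C M (x, \<xi>) = k"
        using e t a z k' by (auto simp: h_def p counit_def free_def intro!: EM_homI)
      fix r assume r: "r \<in> hom ?E (x, \<xi>) p \<and> r \<odot>\<^bsub>?E\<^esub> counit C M (x, \<xi>) = k"
      then obtain r' where r': "r = ((x, \<xi>), (z, \<zeta>), r')" "r' \<in> hom C x z"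
        using p by (auto elim: EM_homE)
      then have "k' = r' \<odot> \<xi>" using r k' by (simp add: counit_def)
      then have "k' \<odot> eta M x = r'"
        using comp_assoc[OF eta_hom[OF x(1)] x(2) r'(2)] x comp_ident[OF r'(2)] by simp
      then show "r = h" using r' by (simp add: h_def)
    qed
  qed
qed

context
  fixes x y :: 'o and \<xi> \<theta> :: 'm and k l :: "'o \<times> 'm \<times> 'm"
  assumes a: "(x, \<xi>) \<in> Obj (EM C M)" and b: "(y, \<theta>) \<in> Obj (EM C M)"
    and k: "is_coproduct C x y k" and l: "is_coproduct C (MO M x) (MO M y) l"
begin

lemma carrier: "x \<in> Obj C" "y \<in> Obj C" "\<xi> \<in> hom C (MO M x) x" "\<theta> \<in> hom C (MO M y) y"
  "\<xi> \<odot> eta M x = Ident C x" "\<theta> \<odot> eta M y = Ident C y"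
  using a b by (auto simp: EM_Obj)

lemma linton_unfold:
  "linton_fst C M k l (x, \<xi>) (y, \<theta>) =
     coprod_arrow (EM C M) (map_cospan (free C M) l) (map_cospan (free C M) k)
       (counit C M (MO M x, mu M x)) (counit C M (MO M y, mu M y))"
  "linton_snd C M k l (x, \<xi>) (y, \<theta>) =
     coprod_arrow (EM C M) (map_cospan (free C M) l) (map_cospan (free C M) k)
       (FA (free C M) \<xi>) (FA (free C M) \<theta>)"
  by (simp_all add: linton_fst_def linton_snd_def forget_def free_def counit_def)

lemma linton_homs:
  "linton_fst C M k l (x, \<xi>) (y, \<theta>)
     \<in> hom (EM C M) (FO (free C M) (fst l)) (FO (free C M) (fst k))"
  "linton_snd C M k l (x, \<xi>) (y, \<theta>)
     \<in> hom (EM C M) (FO (free C M) (fst l)) (FO (free C M) (fst k))"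
  unfolding linton_unfold
  using EM.coprod_arrow(1)[OF free_coproduct[OF l, unfolded map_cospan_def case_prod_beta]
      free_coproduct[OF k, unfolded map_cospan_def case_prod_beta]]
    counit_hom[OF free_Obj[OF carrier(1)]] counit_hom[OF free_Obj[OF carrier(2)]]
    free_hom[OF carrier(3)] free_hom[OF carrier(4)]
  by (simp_all add: map_cospan_def case_prod_beta)

text \<open>
  Restricted to the two summands, Linton's arrows are the canonical pairs of the two
  algebras. For the total monad this determines the base components of Linton's arrows.
\<close>
lemma linton_coprojections:
  "linton_fst C M k l (x, \<xi>) (y, \<theta>) \<odot>\<^bsub>EM C M\<^esub> FA (free C M) (fst (snd l))
     = FA (free C M) (fst (snd k)) \<odot>\<^bsub>EM C M\<^esub> counit C M (MO M x, mu M x)"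
  "linton_fst C M k l (x, \<xi>) (y, \<theta>) \<odot>\<^bsub>EM C M\<^esub> FA (free C M) (snd (snd l))
     = FA (free C M) (snd (snd k)) \<odot>\<^bsub>EM C M\<^esub> counit C M (MO M y, mu M y)"
  "linton_snd C M k l (x, \<xi>) (y, \<theta>) \<odot>\<^bsub>EM C M\<^esub> FA (free C M) (fst (snd l))
     = FA (free C M) (fst (snd k)) \<odot>\<^bsub>EM C M\<^esub> FA (free C M) \<xi>"
  "linton_snd C M k l (x, \<xi>) (y, \<theta>) \<odot>\<^bsub>EM C M\<^esub> FA (free C M) (snd (snd l))
     = FA (free C M) (snd (snd k)) \<odot>\<^bsub>EM C M\<^esub> FA (free C M) \<theta>"
  unfolding linton_unfold
  using EM.coprod_arrow(2,3)[OF free_coproduct[OF l, unfolded map_cospan_def case_prod_beta]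
      free_coproduct[OF k, unfolded map_cospan_def case_prod_beta]]
    counit_hom[OF free_Obj[OF carrier(1)]] counit_hom[OF free_Obj[OF carrier(2)]]
    free_hom[OF carrier(3)] free_hom[OF carrier(4)]
  by (simp_all add: map_cospan_def case_prod_beta)

lemma linton_reflexive:
  "reflexive_pair (EM C M) (linton_fst C M k l (x, \<xi>) (y, \<theta>)) (linton_snd C M k l (x, \<xi>) (y, \<theta>))"
proof -
  let ?E = "EM C M" and ?F = "free C M"
  \<comment> \<open>Each canonical pair has the common section \<open>\<Phi> (eta M x)\<close>.\<close>
  let ?r = "coprod_arrow ?E (map_cospan ?F k) (map_cospan ?F l) (FA ?F (eta M x)) (FA ?F (eta M y))"
  let ?f = "linton_fst C M k l (x, \<xi>) (y, \<theta>)" and ?g = "linton_snd C M k l (x, \<xi>) (y, \<theta>)"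
  note k' = free_coproduct[OF k, unfolded map_cospan_def case_prod_beta]
    and l' = free_coproduct[OF l, unfolded map_cospan_def case_prod_beta]
  note e = free_hom[OF eta_hom[OF carrier(1)]] free_hom[OF eta_hom[OF carrier(2)]]
  note cu = counit_hom[OF free_Obj[OF carrier(1)]] counit_hom[OF free_Obj[OF carrier(2)]]
  have 1: "counit C M (MO M z, mu M z) \<odot>\<^bsub>?E\<^esub> FA ?F (eta M z) = Ident ?E (MO M z, mu M z)"
    if "z \<in> Obj C" for z
    using free_FA[OF eta_hom[OF that]] mu_MA_eta[OF that] by (simp add: counit_def)
  have 2: "FA ?F \<zeta> \<odot>\<^bsub>?E\<^esub> FA ?F (eta M z) = Ident ?E (MO M z, mu M z)"
    if "z \<in> Obj C" "\<zeta> \<in> hom C (MO M z) z" "\<zeta> \<odot> eta M z = Ident C z" for z \<zeta>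
    using free_comp[OF eta_hom[OF that(1)] that(2)] that(3) free_Ident[OF that(1)] by simp
  have "?f \<odot>\<^bsub>?E\<^esub> ?r = Ident ?E (FO ?F (fst k))"
    unfolding linton_unfold
    using EM.coprod_arrow_split_epi[OF l' k' cu(1) cu(2) e(1) 1[OF carrier(1)] e(2) 1[OF carrier(2)]]
    by (simp add: map_cospan_def case_prod_beta)
  moreover have "?g \<odot>\<^bsub>?E\<^esub> ?r = Ident ?E (FO ?F (fst k))"
    unfolding linton_unfold
    using EM.coprod_arrow_split_epi[OF l' k' free_hom[OF carrier(3)] free_hom[OF carrier(4)]
        e(1) 2[OF carrier(1,3,5)] e(2) 2[OF carrier(2,4,6)]]
    by (simp add: map_cospan_def case_prod_beta)
  moreover have "?r \<in> hom ?E (FO ?F (fst k)) (FO ?F (fst l))"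
    using EM.coprod_arrow(1)[OF k' l' e] by (simp add: map_cospan_def case_prod_beta)
  ultimately show ?thesis
    using homD[OF linton_homs(1)] homD[OF linton_homs(2)]
    by (auto simp: reflexive_pair_def parallel_def simp del: EM_simps)
qed

lemma linton_coproduct:
  assumes q: "is_coequaliser (EM C M) (linton_fst C M k l (x, \<xi>) (y, \<theta>))
    (linton_snd C M k l (x, \<xi>) (y, \<theta>)) c q"
  shows "\<exists>m n. is_coproduct (EM C M) (x, \<xi>) (y, \<theta>) (c, m, n) \<and>
    m \<odot>\<^bsub>EM C M\<^esub> counit C M (x, \<xi>) = q \<odot>\<^bsub>EM C M\<^esub> FA (free C M) (fst (snd k)) \<and>
    n \<odot>\<^bsub>EM C M\<^esub> counit C M (y, \<theta>) = q \<odot>\<^bsub>EM C M\<^esub> FA (free C M) (snd (snd k))"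
proof -
  obtain s i j where kk: "k = (s, i, j)" by (cases k)
  obtain t i' j' where ll: "l = (t, i', j')" by (cases l)
  note F = map_cospan_def prod.case
  show ?thesis
    using EM.coproduct_of_coequalisers[OF counit_hom[OF free_Obj[OF carrier(1)]]
        free_hom[OF carrier(3)] counit_hom[OF free_Obj[OF carrier(2)]] free_hom[OF carrier(4)]
        counit_coequaliser[OF a] counit_coequaliser[OF b]
        free_coproduct[OF l, unfolded ll F] free_coproduct[OF k, unfolded kk F]
        q[unfolded linton_unfold, unfolded kk ll F]]
    unfolding kk by simp
qed

end

end

section \<open>Colimits in the fibres of a fibration\<close>

text \<open>
  The fibre of \<open>P\<close> over an object is given by an inclusion functor \<open>J\<close>, and \<open>d\<close> is an arrow from the
  object \<open>r\<close> of the fibre to \<open>z\<close>. The condition is the weak form of cartesianness, which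
  tests \<open>d\<close> only against arrows over the same base arrow as \<open>d\<close> itself.
\<close>
definition precartesian ::
    "('s, 't) cat \<Rightarrow> ('e, 'd) cat \<Rightarrow> ('s, 't, 'a, 'f) fctr \<Rightarrow> ('e, 'd, 's, 't) fctr
      \<Rightarrow> 'e \<Rightarrow> 't \<Rightarrow> 's \<Rightarrow> bool" where
  "precartesian S E P J r d z \<longleftrightarrow> r \<in> Obj E \<and> d \<in> hom S (FO J r) z \<and>
     (\<forall>x\<in>Obj E. \<forall>h\<in>hom S (FO J x) z. FA P h = FA P d \<longrightarrow>
        (\<exists>!h\<^sub>0. h\<^sub>0 \<in> hom E x r \<and> d \<odot>\<^bsub>S\<^esub> FA J h\<^sub>0 = h))"

text \<open>
  \<open>E\<close> is the fibre of \<open>P\<close> over \<open>a\<close>, up to the identification \<open>J\<close>. Only the fibre over \<open>a\<close> is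
  considered, so the existence of precartesian lifts is required only for arrows out of
  \<open>a\<close>.
\<close>
locale fibre_of = S: category S + E: category E + A: category A
  for S :: "('s, 't) cat" and E :: "('e, 'd) cat" and A :: "('a, 'f) cat" +
  fixes P :: "('s, 't, 'a, 'f) fctr" and J :: "('e, 'd, 's, 't) fctr" and a :: 'a
  assumes P: "is_functor S A P" and J: "is_functor E S J"
    and base_Obj: "a \<in> Obj A"
    and J_vertical: "f \<in> Arr E \<Longrightarrow> FA P (FA J f) = Ident A a"
    and J_inj: "\<lbrakk>f \<in> hom E x y; g \<in> hom E x y; FA J f = FA J g\<rbrakk> \<Longrightarrow> f = g"
    and vertical_lift: "\<lbrakk>x \<in> Obj E; y \<in> Obj E; h \<in> hom S (FO J x) (FO J y); FA P h = Ident A a\<rbrakk>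
      \<Longrightarrow> \<exists>h\<^sub>0\<in>hom E x y. FA J h\<^sub>0 = h"
    and cartesian: "\<lbrakk>z \<in> Obj S; u \<in> hom A a (FO P z)\<rbrakk> \<Longrightarrow>
      \<exists>r d. precartesian S E P J r d z \<and> FA P d = u"
begin

lemma J_Obj: "x \<in> Obj E \<Longrightarrow> FO P (FO J x) = a"
proof -
  assume x: "x \<in> Obj E"
  have "FA P (FA J (Ident E x)) = Ident A a" using E.Ident_Arr[OF x] by (simp add: J_vertical)
  moreover have "FA P (FA J (Ident E x)) = Ident A (FO P (FO J x))"
    using functor_Ident[OF J x] functor_Ident[OF P functor_Obj[OF J x]] by simp
  ultimately show ?thesis
    using A.Ident_Arr(2)[OF base_Obj] A.Ident_Arr(2)[OF functor_Obj[OF P functor_Obj[OF J x]]] by simp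
qed

lemma J_hom: "f \<in> hom E x y \<Longrightarrow> FA J f \<in> hom S (FO J x) (FO J y)"
  by (rule functor_hom[OF J])

lemma P_hom: "x \<in> Obj E \<Longrightarrow> h \<in> hom S (FO J x) z \<Longrightarrow> FA P h \<in> hom A a (FO P z)"
  using functor_hom[OF P] J_Obj by metis

lemma P_comp_vertical:
  assumes f: "f \<in> hom E x y" and h: "h \<in> hom S (FO J y) z"
  shows "FA P (h \<odot>\<^bsub>S\<^esub> FA J f) = FA P h"
  using functor_comp[OF P J_hom[OF f] h] J_vertical[OF homD(1)[OF f]]
    A.comp_ident[OF P_hom[OF E.hom_Obj(2)[OF f] h]] by simp

lemma precartesian_lift:
  assumes "precartesian S E P J r d z" "x \<in> Obj E" "h \<in> hom S (FO J x) z" "FA P h = FA P d"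
  obtains h\<^sub>0 where "h\<^sub>0 \<in> hom E x r" "d \<odot>\<^bsub>S\<^esub> FA J h\<^sub>0 = h"
proof -
  have "\<exists>!h\<^sub>0. h\<^sub>0 \<in> hom E x r \<and> d \<odot>\<^bsub>S\<^esub> FA J h\<^sub>0 = h"
    using assms(1)[unfolded precartesian_def, THEN conjunct2, THEN conjunct2, rule_format,
        OF assms(2-4)] .
  then show ?thesis using that by blast
qed

text \<open>
  With \<open>precartesian_lift\<close> and \<open>precartesian_ext\<close>, this makes composition with \<open>d\<close> a bijection,
  natural in \<open>x\<close>, between arrows \<open>x \<rightarrow> r\<close> of the fibre and arrows from \<open>x\<close> to \<open>z\<close> over \<open>FA P d\<close>.
\<close>
lemma precartesian_comp:
  assumes "precartesian S E P J r d z" and e: "e \<in> hom E x y" and h: "h \<in> hom E y r"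
  shows "d \<odot>\<^bsub>S\<^esub> FA J (h \<odot>\<^bsub>E\<^esub> e) = (d \<odot>\<^bsub>S\<^esub> FA J h) \<odot>\<^bsub>S\<^esub> FA J e"
proof -
  have d: "d \<in> hom S (FO J r) z" using assms(1) by (simp add: precartesian_def)
  show ?thesis using functor_comp[OF J e h] S.comp_assoc[OF J_hom[OF e] J_hom[OF h] d] by simp
qed

lemma precartesian_ext:
  assumes c: "precartesian S E P J r d z" and e: "e \<in> hom E x r" "e' \<in> hom E x r"
    and eq: "d \<odot>\<^bsub>S\<^esub> FA J e = d \<odot>\<^bsub>S\<^esub> FA J e'"
  shows "e = e'"
proof -
  have d: "d \<in> hom S (FO J r) z" using c by (simp add: precartesian_def)
  have "\<exists>!h\<^sub>0. h\<^sub>0 \<in> hom E x r \<and> d \<odot>\<^bsub>S\<^esub> FA J h\<^sub>0 = d \<odot>\<^bsub>S\<^esub> FA J e"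
    by (rule c[unfolded precartesian_def, THEN conjunct2, THEN conjunct2, rule_format])
      (use E.hom_Obj(1)[OF e(1)] S.comp_in_hom[OF J_hom[OF e(1)] d] P_comp_vertical[OF e(1) d]
        in simp_all)
  then have "\<exists>\<^sub>\<le>\<^sub>1h\<^sub>0. h\<^sub>0 \<in> hom E x r \<and> d \<odot>\<^bsub>S\<^esub> FA J h\<^sub>0 = d \<odot>\<^bsub>S\<^esub> FA J e"
    by (simp add: ex1_iff_ex_Uniq)
  then show ?thesis by (rule Uniq_D) (use e eq in simp_all)
qed

text \<open>
  A section of a vertical arrow is itself vertical, so a common section in the total category is
  one in the fibre.
\<close>
lemma fibre_reflexive:
  assumes f: "f \<in> hom E x y" and g: "g \<in> hom E x y"
    and r: "reflexive_pair S (FA J f) (FA J g)"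
  shows "reflexive_pair E f g"
proof -
  note xy = E.hom_Obj[OF f] and ff = J_hom[OF f] and gg = J_hom[OF g]
  obtain s where s: "s \<in> hom S (FO J y) (FO J x)" "FA J f \<odot>\<^bsub>S\<^esub> s = Ident S (FO J y)"
      "FA J g \<odot>\<^bsub>S\<^esub> s = Ident S (FO J y)"
    using r homD[OF ff] by (auto simp: reflexive_pair_def)
  have "Ident A a = FA P (FA J f) \<odot>\<^bsub>A\<^esub> FA P s"
    using functor_comp[OF P s(1) ff] s(2) functor_Ident[OF P functor_Obj[OF J xy(2)]]
      J_Obj[OF xy(2)] by simp
  also have "\<dots> = FA P s"
    using J_vertical[OF homD(1)[OF f]] A.ident_comp[OF functor_hom[OF P s(1)]] J_Obj xy by simp
  finally obtain s\<^sub>0 where s0: "s\<^sub>0 \<in> hom E y x" "FA J s\<^sub>0 = s"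
    using vertical_lift[OF xy(2,1) s(1)] by metis
  have 1: "Ident E y \<in> hom E y y" by (rule E.ident_in_hom[OF xy(2)])
  have "f \<odot>\<^bsub>E\<^esub> s\<^sub>0 = Ident E y"
    using functor_comp[OF J s0(1) f] s s0 functor_Ident[OF J xy(2)]
    by (intro J_inj[OF E.comp_in_hom[OF s0(1) f] 1]) simp
  moreover have "g \<odot>\<^bsub>E\<^esub> s\<^sub>0 = Ident E y"
    using functor_comp[OF J s0(1) g] s s0 functor_Ident[OF J xy(2)]
    by (intro J_inj[OF E.comp_in_hom[OF s0(1) g] 1]) simp
  ultimately show ?thesis using s0 homD[OF f] homD[OF g]
    by (auto simp: reflexive_pair_def parallel_def)
qed

text \<open>
  An arrow \<open>k\<close> that coequalises the pair factors through a precartesian arrow \<open>d\<close> over its base as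
  \<open>d \<odot> J k0\<close>, and \<open>k0\<close> coequalises the pair in the fibre. Every factorisation of \<open>k\<close>
  through \<open>J q\<close> lies over the same base as \<open>d\<close>, since \<open>J q\<close> is vertical, so it comes from a
  factorisation of \<open>k0\<close> through \<open>q\<close>.
\<close>
lemma fibre_coequaliser_preserve:
  assumes q: "is_coequaliser E f g c q"
  shows "is_coequaliser S (FA J f) (FA J g) (FO J c) (FA J q)"
proof -
  obtain x y where f: "f \<in> hom E x y" and g: "g \<in> hom E x y"
    using q by (auto simp: is_coequaliser_def parallel_def hom_def)
  note qh = E.coequaliser_hom[OF q f]
  note ff = J_hom[OF f] and gg = J_hom[OF g] and qq = J_hom[OF qh]
  have y: "y \<in> Obj E" "c \<in> Obj E" using E.hom_Obj[OF qh] by simp_all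
  show ?thesis unfolding is_coequaliser_def homD(3)[OF ff]
  proof (intro conjI allI impI)
    show "parallel S (FA J f) (FA J g)" using homD[OF ff] homD[OF gg] by (simp add: parallel_def)
    show "FA J q \<in> hom S (FO J y) (FO J c)" by (rule qq)
    show "FA J q \<odot>\<^bsub>S\<^esub> FA J f = FA J q \<odot>\<^bsub>S\<^esub> FA J g"
      using functor_comp[OF J f qh] functor_comp[OF J g qh] E.coequaliser_eq[OF q] by simp
    fix z k assume "k \<in> hom S (FO J y) z \<and> k \<odot>\<^bsub>S\<^esub> FA J f = k \<odot>\<^bsub>S\<^esub> FA J g"
    then have k: "k \<in> hom S (FO J y) z" "k \<odot>\<^bsub>S\<^esub> FA J f = k \<odot>\<^bsub>S\<^esub> FA J g" by auto
    obtain r d where pc: "precartesian S E P J r d z" and Pd: "FA P d = FA P k"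
      using cartesian[OF S.hom_Obj(2)[OF k(1)] P_hom[OF y(1) k(1)]] by blast
    have d: "d \<in> hom S (FO J r) z" using pc by (simp add: precartesian_def)
    note comp = precartesian_comp[OF pc] and ext = precartesian_ext[OF pc]
    obtain k0 where k0: "k0 \<in> hom E y r" "d \<odot>\<^bsub>S\<^esub> FA J k0 = k" by (rule precartesian_lift[OF pc y(1) k(1) Pd[symmetric]])
    have "k0 \<odot>\<^bsub>E\<^esub> f = k0 \<odot>\<^bsub>E\<^esub> g"
      using comp[OF f k0(1)] comp[OF g k0(1)] k0(2) k(2)
      by (intro ext[OF E.comp_in_hom[OF f k0(1)] E.comp_in_hom[OF g k0(1)]]) simp
    then obtain h0 where h0: "h0 \<in> hom E c r" "h0 \<odot>\<^bsub>E\<^esub> q = k0"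
      using E.coequaliser_desc[OF q f k0(1)] by blast
    show "\<exists>!h. h \<in> hom S (FO J c) z \<and> h \<odot>\<^bsub>S\<^esub> FA J q = k"
    proof (rule ex1I[of _ "d \<odot>\<^bsub>S\<^esub> FA J h0"])
      show "d \<odot>\<^bsub>S\<^esub> FA J h0 \<in> hom S (FO J c) z \<and> (d \<odot>\<^bsub>S\<^esub> FA J h0) \<odot>\<^bsub>S\<^esub> FA J q = k"
        using S.comp_in_hom[OF J_hom[OF h0(1)] d] comp[OF qh h0(1)] h0(2) k0(2) by simp
      fix h assume h: "h \<in> hom S (FO J c) z \<and> h \<odot>\<^bsub>S\<^esub> FA J q = k"
      have "FA P h = FA P d" using P_comp_vertical[OF qh conjunct1[OF h]] h Pd by simp
      then obtain h1 where h1: "h1 \<in> hom E c r" "d \<odot>\<^bsub>S\<^esub> FA J h1 = h"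
        by (rule precartesian_lift[OF pc y(2) conjunct1[OF h]])
      have "h1 \<odot>\<^bsub>E\<^esub> q = k0"
        using comp[OF qh h1(1)] h1(2) h k0(2)
        by (intro ext[OF E.comp_in_hom[OF qh h1(1)] k0(1)]) simp
      then show "h = d \<odot>\<^bsub>S\<^esub> FA J h0"
        using E.coequaliser_ext[OF q h1(1) h0(1)] h0(2) h1(2) by simp
    qed
  qed
qed

text \<open>
  A coequaliser \<open>q\<close> in the total category lies over some \<open>u\<close> that is not assumed to be an
  identity, so \<open>q\<close> is not itself in the fibre. The vertical part \<open>p\<close> of its factorisation \<open>d \<odot> J p\<close>
  is; it is a coequaliser because the universal property of \<open>q\<close> provides an inverse \<open>h\<close>
  of \<open>d\<close>.
\<close>
lemma fibre_coequaliser_exists: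
  assumes f: "f \<in> hom E x y" and g: "g \<in> hom E x y"
    and q: "is_coequaliser S (FA J f) (FA J g) z q"
  shows "\<exists>c p. is_coequaliser E f g c p"
proof -
  note ff = J_hom[OF f] and gg = J_hom[OF g]
  note qh = S.coequaliser_hom[OF q ff] and y = E.hom_Obj(2)[OF f]
  obtain r d where pc: "precartesian S E P J r d z" and Pd: "FA P d = FA P q"
    using cartesian[OF S.hom_Obj(2)[OF qh] P_hom[OF y qh]] by blast
  have d: "r \<in> Obj E" "d \<in> hom S (FO J r) z" "FA P d = FA P q"
    using pc Pd by (simp_all add: precartesian_def)
  note comp = precartesian_comp[OF pc] and ext = precartesian_ext[OF pc]
  obtain p where p: "p \<in> hom E y r" "d \<odot>\<^bsub>S\<^esub> FA J p = q" by (rule precartesian_lift[OF pc y qh Pd[symmetric]])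
  note pp = J_hom[OF p(1)]
  have pfg: "p \<odot>\<^bsub>E\<^esub> f = p \<odot>\<^bsub>E\<^esub> g"
    using comp[OF f p(1)] comp[OF g p(1)] p(2) S.coequaliser_eq[OF q]
    by (intro ext[OF E.comp_in_hom[OF f p(1)] E.comp_in_hom[OF g p(1)]]) simp
  then have "FA J p \<odot>\<^bsub>S\<^esub> FA J f = FA J p \<odot>\<^bsub>S\<^esub> FA J g"
    using functor_comp[OF J f p(1)] functor_comp[OF J g p(1)] by simp
  then obtain h where h: "h \<in> hom S z (FO J r)" "h \<odot>\<^bsub>S\<^esub> q = FA J p"
    using S.coequaliser_desc[OF q ff pp] by blast
  have "(d \<odot>\<^bsub>S\<^esub> h) \<odot>\<^bsub>S\<^esub> q = Ident S z \<odot>\<^bsub>S\<^esub> q"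
    using S.comp_assoc[OF qh h(1) d(2)] h(2) p(2) S.ident_comp[OF qh] by simp
  then have dh: "d \<odot>\<^bsub>S\<^esub> h = Ident S z"
    by (rule S.coequaliser_ext[OF q S.comp_in_hom[OF h(1) d(2)]
      S.ident_in_hom[OF S.hom_Obj(2)[OF d(2)]]])
  have hd: "h \<odot>\<^bsub>S\<^esub> d \<in> hom S (FO J r) (FO J r)" by (rule S.comp_in_hom[OF d(2) h(1)])
  \<comment> \<open>Since \<open>d\<close> and \<open>q\<close> have the same base, \<open>h \<odot> d\<close> has that of \<open>h \<odot> q = J p\<close>, so it is vertical.\<close>
  have "FA P (h \<odot>\<^bsub>S\<^esub> d) = FA P (h \<odot>\<^bsub>S\<^esub> q)"
    using functor_comp[OF P d(2) h(1)] functor_comp[OF P qh h(1)] d(3) by simp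
  then have "FA P (h \<odot>\<^bsub>S\<^esub> d) = Ident A a" using h(2) J_vertical[OF homD(1)[OF p(1)]] by simp
  then obtain e where e: "e \<in> hom E r r" "FA J e = h \<odot>\<^bsub>S\<^esub> d"
    using vertical_lift[OF d(1,1) hd] by blast
  have "d \<odot>\<^bsub>S\<^esub> FA J e = d \<odot>\<^bsub>S\<^esub> FA J (Ident E r)"
    using S.comp_assoc[OF d(2) h(1) d(2)] dh S.ident_comp[OF d(2)] S.comp_ident[OF d(2)]
      functor_Ident[OF J d(1)] e(2) by simp
  then have "e = Ident E r" by (rule ext[OF e(1) E.ident_in_hom[OF d(1)]])
  then have hd1: "h \<odot>\<^bsub>S\<^esub> d = Ident S (FO J r)" using e(2) functor_Ident[OF J d(1)] by simp
  have "is_coequaliser E f g r p" unfolding is_coequaliser_def homD(3)[OF f]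
  proof (intro conjI allI impI)
    show "parallel E f g" using homD[OF f] homD[OF g] by (simp add: parallel_def)
    show "p \<in> hom E y r" by (rule p(1))
    show "p \<odot>\<^bsub>E\<^esub> f = p \<odot>\<^bsub>E\<^esub> g" by (rule pfg)
    fix v k assume k: "k \<in> hom E y v \<and> k \<odot>\<^bsub>E\<^esub> f = k \<odot>\<^bsub>E\<^esub> g"
    then have k1: "k \<in> hom E y v" by simp
    note kk = J_hom[OF k1]
    have "FA J k \<odot>\<^bsub>S\<^esub> FA J f = FA J k \<odot>\<^bsub>S\<^esub> FA J g"
      using functor_comp[OF J f k1] functor_comp[OF J g k1] k by simp
    then obtain w where w: "w \<in> hom S z (FO J v)" "w \<odot>\<^bsub>S\<^esub> q = FA J k"
      using S.coequaliser_desc[OF q ff kk] by blast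
    \<comment> \<open>\<open>d\<close> identifies \<open>p\<close> with \<open>q\<close>, so \<open>w \<odot> d\<close> is the factorisation of \<open>J k\<close> through \<open>J p\<close>.\<close>
    have wd: "w \<odot>\<^bsub>S\<^esub> d \<in> hom S (FO J r) (FO J v)" by (rule S.comp_in_hom[OF d(2) w(1)])
    have wdp: "(w \<odot>\<^bsub>S\<^esub> d) \<odot>\<^bsub>S\<^esub> FA J p = FA J k"
      using S.comp_assoc[OF pp d(2) w(1)] p(2) w(2) by simp
    then have "FA P (w \<odot>\<^bsub>S\<^esub> d) = Ident A a"
      using P_comp_vertical[OF p(1) wd] J_vertical[OF homD(1)[OF k1]] by simp
    then obtain h0 where h0: "h0 \<in> hom E r v" "FA J h0 = w \<odot>\<^bsub>S\<^esub> d"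
      using vertical_lift[OF d(1) E.hom_Obj(2)[OF k1] wd] by blast
    show "\<exists>!h. h \<in> hom E r v \<and> h \<odot>\<^bsub>E\<^esub> p = k"
    proof (rule ex1I[of _ h0])
      have "h0 \<odot>\<^bsub>E\<^esub> p = k"
        using functor_comp[OF J p(1) h0(1)] h0(2) wdp
        by (intro J_inj[OF E.comp_in_hom[OF p(1) h0(1)] k1]) simp
      then show "h0 \<in> hom E r v \<and> h0 \<odot>\<^bsub>E\<^esub> p = k" using h0(1) by simp
      fix h1 assume h1: "h1 \<in> hom E r v \<and> h1 \<odot>\<^bsub>E\<^esub> p = k"
      then have h1': "h1 \<in> hom E r v" by simp
      note hh = J_hom[OF h1']
      have "(FA J h1 \<odot>\<^bsub>S\<^esub> h) \<odot>\<^bsub>S\<^esub> q = w \<odot>\<^bsub>S\<^esub> q"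
        using S.comp_assoc[OF qh h(1) hh] h(2) functor_comp[OF J p(1) h1'] h1 w(2) by simp
      then have "FA J h1 \<odot>\<^bsub>S\<^esub> h = w"
        by (rule S.coequaliser_ext[OF q S.comp_in_hom[OF h(1) hh] w(1)])
      then have "FA J h1 = w \<odot>\<^bsub>S\<^esub> d"
        using S.comp_assoc[OF d(2) h(1) hh] hd1 S.comp_ident[OF hh] by simp
      then show "h1 = h0" using J_inj[OF h1' h0(1)] h0(2) by simp
    qed
  qed
  then show ?thesis by blast
qed

end

section \<open>Products of categories\<close>

lemma prod_cat_simps [simp]:
  "Obj (prod_cat C D) = Obj C \<times> Obj D" "Arr (prod_cat C D) = Arr C \<times> Arr D"
  "Dom (prod_cat C D) (f, g) = (Dom C f, Dom D g)"
  "Cod (prod_cat C D) (f, g) = (Cod C f, Cod D g)"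
  "Ident (prod_cat C D) (x, y) = (Ident C x, Ident D y)"
  "(f', g') \<odot>\<^bsub>prod_cat C D\<^esub> (f, g) = (f' \<odot>\<^bsub>C\<^esub> f, g' \<odot>\<^bsub>D\<^esub> g)"
  by (simp_all add: prod_cat_def)

lemma prod_hom [simp]:
  "(f, g) \<in> hom (prod_cat C D) (x, y) (x', y') \<longleftrightarrow> f \<in> hom C x x' \<and> g \<in> hom D y y'"
  by (auto simp: hom_def)

lemma prod_category:
  assumes "category C" "category D"
  shows "category (prod_cat C D)"
proof -
  interpret C: category C by fact
  interpret D: category D by fact
  show ?thesis
  proof
    fix f assume "f \<in> Arr (prod_cat C D)"
    then show "Dom (prod_cat C D) f \<in> Obj (prod_cat C D)" "Cod (prod_cat C D) f \<in> Obj (prod_cat C D)"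
      by (auto simp: C.dom_in_Obj D.dom_in_Obj C.cod_in_Obj D.cod_in_Obj)
  next
    fix x assume "x \<in> Obj (prod_cat C D)"
    then show "Ident (prod_cat C D) x \<in> hom (prod_cat C D) x x"
      by (auto simp: C.ident_in_hom D.ident_in_hom)
  next
    fix f g x y z assume "f \<in> hom (prod_cat C D) x y" "g \<in> hom (prod_cat C D) y z"
    then show "g \<odot>\<^bsub>prod_cat C D\<^esub> f \<in> hom (prod_cat C D) x z"
      by (cases f; cases g; cases x; cases y; cases z) (auto intro: C.comp_in_hom D.comp_in_hom)
  next
    fix f x y assume "f \<in> hom (prod_cat C D) x y"
    then show "f \<odot>\<^bsub>prod_cat C D\<^esub> Ident (prod_cat C D) x = f"
      "Ident (prod_cat C D) y \<odot>\<^bsub>prod_cat C D\<^esub> f = f"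
      by (cases f; cases x; cases y;
        auto simp: C.comp_ident D.comp_ident C.ident_comp D.ident_comp)+
  next
    fix f g h w x y z
    assume "f \<in> hom (prod_cat C D) w x" "g \<in> hom (prod_cat C D) x y" "h \<in> hom (prod_cat C D) y z"
    then show "(h \<odot>\<^bsub>prod_cat C D\<^esub> g) \<odot>\<^bsub>prod_cat C D\<^esub> f
        = h \<odot>\<^bsub>prod_cat C D\<^esub> (g \<odot>\<^bsub>prod_cat C D\<^esub> f)"
      by (cases f; cases g; cases h; cases w; cases x; cases y; cases z)
        (auto simp: C.comp_assoc D.comp_assoc)
  qed
qed

lemma pair_coproduct:
  assumes C: "category C" and D: "category D"
    and k: "is_coproduct C x y k" and l: "is_coproduct D x' y' l"
  shows "is_coproduct (prod_cat C D) (x, x') (y, y') (pair_cospan k l)"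
proof -
  interpret C: category C by fact
  interpret D: category D by fact
  obtain s i j where kk: "k = (s, i, j)" by (cases k)
  obtain t i' j' where ll: "l = (t, i', j')" by (cases l)
  note k = k[unfolded kk] and l = l[unfolded ll]
  have "is_coproduct (prod_cat C D) (x, x') (y, y') ((s, t), (i, i'), (j, j'))"
    unfolding is_coproduct_def prod.case
  proof (intro conjI allI impI)
    fix p f g
    assume fg: "f \<in> hom (prod_cat C D) (x, x') p \<and> g \<in> hom (prod_cat C D) (y, y') p"
    obtain z z' f1 f2 g1 g2 where [simp]: "p = (z, z')" "f = (f1, f2)" "g = (g1, g2)"
      by (metis surj_pair)
    have f: "f1 \<in> hom C x z" "f2 \<in> hom D x' z'" and g: "g1 \<in> hom C y z" "g2 \<in> hom D y' z'"
      using fg by auto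
    obtain h1 where h1: "h1 \<in> hom C s z" "h1 \<odot>\<^bsub>C\<^esub> i = f1" "h1 \<odot>\<^bsub>C\<^esub> j = g1"
      by (rule C.copair_exists[OF k f(1) g(1)])
    obtain h2 where h2: "h2 \<in> hom D t z'" "h2 \<odot>\<^bsub>D\<^esub> i' = f2" "h2 \<odot>\<^bsub>D\<^esub> j' = g2"
      by (rule D.copair_exists[OF l f(2) g(2)])
    show "\<exists>!h. h \<in> hom (prod_cat C D) (s, t) p \<and> h \<odot>\<^bsub>prod_cat C D\<^esub> (i, i') = f \<and>
        h \<odot>\<^bsub>prod_cat C D\<^esub> (j, j') = g"
    proof (rule ex1I[of _ "(h1, h2)"])
      show "(h1, h2) \<in> hom (prod_cat C D) (s, t) p \<and> (h1, h2) \<odot>\<^bsub>prod_cat C D\<^esub> (i, i') = f \<and>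
          (h1, h2) \<odot>\<^bsub>prod_cat C D\<^esub> (j, j') = g" using h1 h2 by simp
      fix h assume h: "h \<in> hom (prod_cat C D) (s, t) p \<and> h \<odot>\<^bsub>prod_cat C D\<^esub> (i, i') = f \<and>
          h \<odot>\<^bsub>prod_cat C D\<^esub> (j, j') = g"
      obtain r1 r2 where [simp]: "h = (r1, r2)" by (cases h)
      show "h = (h1, h2)"
        using C.coproduct_ext[OF k _ h1(1), of r1] D.coproduct_ext[OF l _ h2(1), of r2] h h1 h2
        by simp
    qed
  qed (use k l in \<open>auto simp: is_coproduct_def\<close>)
  then show ?thesis by (simp add: pair_cospan_def kk ll)
qed

section \<open>The total monad of a parametrized monad\<close>

text \<open>
  A monad morphism \<open>M \<rightarrow> N\<close> turns \<open>N\<close>-algebras into \<open>M\<close>-algebras with the same carrier; for the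
  monad morphisms \<open>T u\<close> this is the reindexing of the fibration over the parameters.
\<close>
lemma monad_morphism_restrict:
  assumes \<tau>: "is_monad_morphism C M N \<tau>" and w: "(w, \<omega>) \<in> Obj (EM C N)"
  shows "(w, \<omega> \<odot>\<^bsub>C\<^esub> \<tau> w) \<in> Obj (EM C M)"
proof -
  have MN: "is_monad C M" "is_monad C N" using \<tau> by (simp_all add: is_monad_morphism_def)
  then have "category C" by (simp add: is_monad_def is_functor_def)
  then interpret C: category C .
  interpret M: monad_on C M by unfold_locales fact
  interpret N: monad_on C N by unfold_locales fact
  have t: "\<tau> x \<in> hom C (MO M x) (MO N x)" if "x \<in> Obj C" for x
    using \<tau> that by (auto simp: is_monad_morphism_def)
  have nat: "\<tau> y \<odot>\<^bsub>C\<^esub> MA M f = MA N f \<odot>\<^bsub>C\<^esub> \<tau> x" if "f \<in> hom C x y" for f x y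
    using \<tau> homD[OF that] by (auto simp: is_monad_morphism_def)
  have x: "w \<in> Obj C" "\<omega> \<in> hom C (MO N w) w" "\<omega> \<odot>\<^bsub>C\<^esub> eta N w = Ident C w"
    "\<omega> \<odot>\<^bsub>C\<^esub> mu N w = \<omega> \<odot>\<^bsub>C\<^esub> MA N \<omega>" using w by (auto simp: EM_Obj)
  have te: "\<tau> w \<odot>\<^bsub>C\<^esub> eta M w = eta N w"
    and tm: "\<tau> w \<odot>\<^bsub>C\<^esub> mu M w = mu N w \<odot>\<^bsub>C\<^esub> (\<tau> (MO N w) \<odot>\<^bsub>C\<^esub> MA M (\<tau> w))"
    using \<tau> x(1) by (simp_all add: is_monad_morphism_def)
  note tw = t[OF x(1)] and tN = t[OF N.MO_Obj[OF x(1)]]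
  note Mt = M.MA_hom[OF tw]
  have "(\<omega> \<odot>\<^bsub>C\<^esub> \<tau> w) \<odot>\<^bsub>C\<^esub> eta M w = Ident C w"
    using C.comp_assoc[OF M.eta_hom[OF x(1)] tw x(2)] te x(3) by simp
  moreover have "(\<omega> \<odot>\<^bsub>C\<^esub> \<tau> w) \<odot>\<^bsub>C\<^esub> mu M w = (\<omega> \<odot>\<^bsub>C\<^esub> \<tau> w) \<odot>\<^bsub>C\<^esub> MA M (\<omega> \<odot>\<^bsub>C\<^esub> \<tau> w)"
  proof -
    have "(\<omega> \<odot>\<^bsub>C\<^esub> \<tau> w) \<odot>\<^bsub>C\<^esub> mu M w = \<omega> \<odot>\<^bsub>C\<^esub> (mu N w \<odot>\<^bsub>C\<^esub> (\<tau> (MO N w) \<odot>\<^bsub>C\<^esub> MA M (\<tau> w)))"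
      using C.comp_assoc[OF M.mu_hom[OF x(1)] tw x(2)] tm by simp
    also have "\<dots> = (\<omega> \<odot>\<^bsub>C\<^esub> MA N \<omega>) \<odot>\<^bsub>C\<^esub> (\<tau> (MO N w) \<odot>\<^bsub>C\<^esub> MA M (\<tau> w))"
      using C.comp_assoc[OF C.comp_in_hom[OF Mt tN] N.mu_hom[OF x(1)] x(2)] x(4) by simp
    also have "\<dots> = \<omega> \<odot>\<^bsub>C\<^esub> ((MA N \<omega> \<odot>\<^bsub>C\<^esub> \<tau> (MO N w)) \<odot>\<^bsub>C\<^esub> MA M (\<tau> w))"
      using C.comp_assoc[OF C.comp_in_hom[OF Mt tN] N.MA_hom[OF x(2)] x(2)]
        C.comp_assoc[OF Mt tN N.MA_hom[OF x(2)]] by simp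
    also have "\<dots> = \<omega> \<odot>\<^bsub>C\<^esub> (\<tau> w \<odot>\<^bsub>C\<^esub> (MA M \<omega> \<odot>\<^bsub>C\<^esub> MA M (\<tau> w)))"
      using nat[OF x(2)] C.comp_assoc[OF Mt M.MA_hom[OF x(2)] tw] by simp
    also have "\<dots> = (\<omega> \<odot>\<^bsub>C\<^esub> \<tau> w) \<odot>\<^bsub>C\<^esub> MA M (\<omega> \<odot>\<^bsub>C\<^esub> \<tau> w)"
      using C.comp_assoc[OF C.comp_in_hom[OF Mt M.MA_hom[OF x(2)]] tw x(2)] M.MA_comp[OF tw x(2)]
      by simp
    finally show ?thesis .
  qed
  ultimately show ?thesis using x C.comp_in_hom[OF tw x(2)] by (simp add: EM_Obj)
qed

locale param_monad = A: category A + X: category X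
  for A :: "('a, 'f) cat" and X :: "('x, 'g) cat" +
  fixes T :: "('a, 'f, 'x, 'g) pmonad"
  assumes T: "parametrized_monad A X T"
begin

abbreviation "tr u \<equiv> snd (snd (FA T u))"
abbreviation "pm \<equiv> pm_arrow A X T"
abbreviation "S \<equiv> semiprod A X T"
abbreviation "H \<equiv> hat A X T"
abbreviation "AX \<equiv> prod_cat A X"

lemma functor_T: "is_functor A (Mnd X) T"
  using T by (simp add: parametrized_monad_def)

lemma fibre_monad: "a \<in> Obj A \<Longrightarrow> monad_on X (FO T a)"
  using functor_Obj[OF functor_T] by unfold_locales (auto simp: Mnd_def)

lemma FA_T:
  assumes "f \<in> hom A a b"
  shows "FA T f = (FO T a, FO T b, tr f)"
  using functor_hom[OF functor_T assms] by (cases "FA T f") (auto simp: hom_def Mnd_def)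

lemma tr_morphism:
  assumes "f \<in> hom A a b"
  shows "is_monad_morphism X (FO T a) (FO T b) (tr f)"
  using functor_hom[OF functor_T assms] FA_T[OF assms] by (auto simp: hom_def Mnd_def)

lemma tr_hom: "f \<in> hom A a b \<Longrightarrow> x \<in> Obj X \<Longrightarrow> tr f x \<in> hom X (MO (FO T a) x) (MO (FO T b) x)"
  using tr_morphism[of f a b] by (auto simp: is_monad_morphism_def)

lemma tr_nat: "f \<in> hom A a b \<Longrightarrow> g \<in> hom X x y
    \<Longrightarrow> tr f y \<odot>\<^bsub>X\<^esub> MA (FO T a) g = MA (FO T b) g \<odot>\<^bsub>X\<^esub> tr f x"
  using tr_morphism[of f a b] homD[of g X x y] by (auto simp: is_monad_morphism_def)

lemma tr_eta: "f \<in> hom A a b \<Longrightarrow> x \<in> Obj X \<Longrightarrow> tr f x \<odot>\<^bsub>X\<^esub> eta (FO T a) x = eta (FO T b) x"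
  using tr_morphism[of f a b] by (auto simp: is_monad_morphism_def)

lemma tr_mu: "f \<in> hom A a b \<Longrightarrow> x \<in> Obj X \<Longrightarrow> tr f x \<odot>\<^bsub>X\<^esub> mu (FO T a) x
    = mu (FO T b) x \<odot>\<^bsub>X\<^esub> (tr f (MO (FO T b) x) \<odot>\<^bsub>X\<^esub> MA (FO T a) (tr f x))"
  using tr_morphism[of f a b] by (auto simp: is_monad_morphism_def)

lemma tr_Ident: "a \<in> Obj A \<Longrightarrow> x \<in> Obj X \<Longrightarrow> tr (Ident A a) x = Ident X (MO (FO T a) x)"
  using functor_Ident[OF functor_T, of a] by (simp add: Mnd_def)

lemma tr_comp:
  assumes "f \<in> hom A a b" "g \<in> hom A b c" "x \<in> Obj X"
  shows "tr (g \<odot>\<^bsub>A\<^esub> f) x = tr g x \<odot>\<^bsub>X\<^esub> tr f x"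
  using functor_comp[OF functor_T assms(1,2)] FA_T[OF assms(1)] FA_T[OF assms(2)] assms(3)
  by (cases "FA T f"; cases "FA T g") (simp add: Mnd_def)

lemma pm_eq:
  assumes "f \<in> hom A a b" "g \<in> hom X x y"
  shows "pm f g = tr f y \<odot>\<^bsub>X\<^esub> MA (FO T a) g"
  using homD[OF assms(1)] homD[OF assms(2)] by (simp add: pm_arrow_def)

lemma MA_T_hom: "a \<in> Obj A \<Longrightarrow> g \<in> hom X x y \<Longrightarrow> MA (FO T a) g \<in> hom X (MO (FO T a) x) (MO (FO T a) y)"
  by (rule monad_on.MA_hom[OF fibre_monad])

lemma pm_hom:
  assumes f: "f \<in> hom A a b" and g: "g \<in> hom X x y"
  shows "pm f g \<in> hom X (MO (FO T a) x) (MO (FO T b) y)"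
  using X.comp_in_hom[OF MA_T_hom[OF A.hom_Obj(1)[OF f] g] tr_hom[OF f X.hom_Obj(2)[OF g]]]
  by (simp add: pm_eq[OF f g])

lemma pm_Ident_base:
  assumes a: "a \<in> Obj A" and g: "g \<in> hom X x y"
  shows "pm (Ident A a) g = MA (FO T a) g"
  using X.ident_comp[OF MA_T_hom[OF a g]] tr_Ident[OF a X.hom_Obj(2)[OF g]]
  by (simp add: pm_eq[OF A.ident_in_hom[OF a] g])

lemma pm_Ident_total:
  assumes f: "f \<in> hom A a b" and x: "x \<in> Obj X"
  shows "pm f (Ident X x) = tr f x"
proof -
  interpret Ta: monad_on X "FO T a" using f by (intro fibre_monad A.hom_Obj)
  show ?thesis
    using Ta.MA_Ident[OF x] X.comp_ident[OF tr_hom[OF f x]]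
    by (simp add: pm_eq[OF f X.ident_in_hom[OF x]])
qed

text \<open>
  Naturality of \<open>tr f\<close> at \<open>g'\<close> is what lets the two variables be interchanged.
\<close>
lemma pm_comp:
  assumes f: "f \<in> hom A a b" and f': "f' \<in> hom A b c"
    and g: "g \<in> hom X x y" and g': "g' \<in> hom X y z"
  shows "pm (f' \<odot>\<^bsub>A\<^esub> f) (g' \<odot>\<^bsub>X\<^esub> g) = pm f' g' \<odot>\<^bsub>X\<^esub> pm f g"
proof -
  have o: "a \<in> Obj A" "b \<in> Obj A" "y \<in> Obj X" "z \<in> Obj X"
    using A.hom_Obj[OF f] X.hom_Obj[OF g'] by simp_all
  interpret Ta: monad_on X "FO T a" by (rule fibre_monad[OF o(1)])
  interpret Tb: monad_on X "FO T b" by (rule fibre_monad[OF o(2)])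
  note h = Ta.MA_hom[OF g] Ta.MA_hom[OF g'] Tb.MA_hom[OF g'] tr_hom[OF f o(3)] tr_hom[OF f o(4)]
    tr_hom[OF f' o(4)]
  have "pm (f' \<odot>\<^bsub>A\<^esub> f) (g' \<odot>\<^bsub>X\<^esub> g)
      = (tr f' z \<odot>\<^bsub>X\<^esub> tr f z) \<odot>\<^bsub>X\<^esub> (MA (FO T a) g' \<odot>\<^bsub>X\<^esub> MA (FO T a) g)"
    by (simp add: pm_eq[OF A.comp_in_hom[OF f f'] X.comp_in_hom[OF g g']] tr_comp[OF f f' o(4)]
        Ta.MA_comp[OF g g'])
  also have "\<dots> = tr f' z \<odot>\<^bsub>X\<^esub> ((tr f z \<odot>\<^bsub>X\<^esub> MA (FO T a) g') \<odot>\<^bsub>X\<^esub> MA (FO T a) g)"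
    using X.comp_assoc[OF X.comp_in_hom[OF h(1,2)] h(5,6)] X.comp_assoc[OF h(1,2,5)] by simp
  also have "\<dots> = tr f' z \<odot>\<^bsub>X\<^esub> (MA (FO T b) g' \<odot>\<^bsub>X\<^esub> (tr f y \<odot>\<^bsub>X\<^esub> MA (FO T a) g))"
    using tr_nat[OF f g'] X.comp_assoc[OF h(1,4,3)] by simp
  also have "\<dots> = pm f' g' \<odot>\<^bsub>X\<^esub> pm f g"
    using X.comp_assoc[OF X.comp_in_hom[OF h(1,4)] h(3,6)]
    by (simp add: pm_eq[OF f g] pm_eq[OF f' g'])
  finally show ?thesis .
qed

lemma hat_simps [simp]:
  "MO H (a, x) = (a, MO (FO T a) x)" "MA H (f, g) = (f, pm f g)"
  "eta H (a, x) = (Ident A a, eta (FO T a) x)" "mu H (a, x) = (Ident A a, mu (FO T a) x)"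
  by (simp_all add: hat_def)

lemma hat_functor: "is_functor AX AX (endo H)"
  unfolding is_functor_def
proof (intro conjI ballI impI)
  show "category AX" "category AX" by (rule prod_category; unfold_locales)+
  fix p assume "p \<in> Obj AX"
  then obtain a x where p: "p = (a, x)" "a \<in> Obj A" "x \<in> Obj X" by auto
  interpret Ta: monad_on X "FO T a" by (rule fibre_monad[OF p(2)])
  show "MO H p \<in> Obj AX" using p Ta.MO_Obj by simp
  show "MA H (Ident AX p) = Ident AX (MO H p)"
    using p pm_Ident_total[OF A.ident_in_hom] tr_Ident by simp
next
  fix h assume h: "h \<in> Arr AX"
  then show "MA H h \<in> hom AX (MO H (Dom AX h)) (MO H (Cod AX h))"
    using pm_hom[OF homI homI] by (auto simp: hom_def[of A])
  fix k assume "k \<in> Arr AX" "Cod AX h = Dom AX k"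
  then show "MA H (k \<odot>\<^bsub>AX\<^esub> h) = MA H k \<odot>\<^bsub>AX\<^esub> MA H h"
    using h pm_comp[OF homI homI homI homI] by auto
qed

text \<open>
  In the second variable, naturality of unit and multiplication with respect to an arrow over
  \<open>f\<close> combines their naturality for the monad at \<open>a\<close> with the compatibility of \<open>tr f\<close> with the
  units and multiplications at \<open>a\<close> and \<open>b\<close>. The monad laws only concern arrows over identities
  and hold fibrewise.
\<close>
lemma hat_monad: "is_monad AX H"
  unfolding is_monad_def
proof (intro conjI ballI)
  show "is_functor AX AX (endo H)" by (rule hat_functor)
next
  fix p assume "p \<in> Obj AX"
  then obtain a x where p: "p = (a, x)" "a \<in> Obj A" "x \<in> Obj X" by auto
  interpret Ta: monad_on X "FO T a" by (rule fibre_monad[OF p(2)])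
  note 1 = A.ident_in_hom[OF p(2)]
  note [simp] = A.comp_ident[OF 1]
  show "eta H p \<in> hom AX p (MO H p)" "mu H p \<in> hom AX (MO H (MO H p)) (MO H p)"
    using p 1 Ta.eta_hom Ta.mu_hom by simp_all
  show "mu H p \<odot>\<^bsub>AX\<^esub> eta H (MO H p) = Ident AX (MO H p)"
    "mu H p \<odot>\<^bsub>AX\<^esub> MA H (eta H p) = Ident AX (MO H p)"
    "mu H p \<odot>\<^bsub>AX\<^esub> mu H (MO H p) = mu H p \<odot>\<^bsub>AX\<^esub> MA H (mu H p)"
    using p pm_Ident_base[OF p(2) Ta.eta_hom[OF p(3)]] pm_Ident_base[OF p(2) Ta.mu_hom[OF p(3)]]
      Ta.mu_eta Ta.mu_MA_eta Ta.mu_mu by simp_all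
next
  fix h assume "h \<in> Arr AX"
  then obtain f g where h: "h = (f, g)" "f \<in> Arr A" "g \<in> Arr X" by auto
  define a b x y where "a = Dom A f" "b = Cod A f" "x = Dom X g" "y = Cod X g"
  then have f: "f \<in> hom A a b" and g: "g \<in> hom X x y" using h by (auto simp: hom_def)
  have dc: "Dom AX h = (a, x)" "Cod AX h = (b, y)" using h homD[OF f] homD[OF g] by simp_all
  have o: "a \<in> Obj A" "b \<in> Obj A" "x \<in> Obj X" "y \<in> Obj X"
    using A.hom_Obj[OF f] X.hom_Obj[OF g] by simp_all
  interpret Ta: monad_on X "FO T a" by (rule fibre_monad[OF o(1)])
  interpret Tb: monad_on X "FO T b" by (rule fibre_monad[OF o(2)])
  note [simp] = A.comp_ident[OF f] A.ident_comp[OF f]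
  have "pm f g \<odot>\<^bsub>X\<^esub> eta (FO T a) x = tr f y \<odot>\<^bsub>X\<^esub> (eta (FO T a) y \<odot>\<^bsub>X\<^esub> g)"
    using X.comp_assoc[OF Ta.eta_hom[OF o(3)] Ta.MA_hom[OF g] tr_hom[OF f o(4)]] Ta.eta_nat[OF g]
    by (simp add: pm_eq[OF f g])
  also have "\<dots> = eta (FO T b) y \<odot>\<^bsub>X\<^esub> g"
    using X.comp_assoc[OF g Ta.eta_hom[OF o(4)] tr_hom[OF f o(4)]] tr_eta[OF f o(4)] by simp
  finally show "eta H (Cod AX h) \<odot>\<^bsub>AX\<^esub> h = MA H h \<odot>\<^bsub>AX\<^esub> eta H (Dom AX h)"
    unfolding dc by (simp add: h)
  let ?a = "FO T a" and ?b = "FO T b"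
  note t = tr_hom[OF f o(4)] and tb = tr_hom[OF f Tb.MO_Obj[OF o(4)]]
  note Mg = Ta.MA_hom[OF g] and Mt = Ta.MA_hom[OF t]
  note MMg = Ta.MA_hom[OF Mg]
  have "mu ?b y \<odot>\<^bsub>X\<^esub> pm f (pm f g)
      = mu ?b y \<odot>\<^bsub>X\<^esub> (tr f (MO ?b y) \<odot>\<^bsub>X\<^esub> (MA ?a (tr f y) \<odot>\<^bsub>X\<^esub> MA ?a (MA ?a g)))"
    using pm_eq[OF f pm_hom[OF f g]] pm_eq[OF f g] Ta.MA_comp[OF Mg t] by simp
  also have "\<dots> = (mu ?b y \<odot>\<^bsub>X\<^esub> (tr f (MO ?b y) \<odot>\<^bsub>X\<^esub> MA ?a (tr f y))) \<odot>\<^bsub>X\<^esub> MA ?a (MA ?a g)"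
    using X.comp_assoc[OF MMg Mt tb]
      X.comp_assoc[OF MMg X.comp_in_hom[OF Mt tb] Tb.mu_hom[OF o(4)]] by simp
  also have "\<dots> = tr f y \<odot>\<^bsub>X\<^esub> (MA ?a g \<odot>\<^bsub>X\<^esub> mu ?a x)"
    using tr_mu[OF f o(4)] X.comp_assoc[OF MMg Ta.mu_hom[OF o(4)] t] Ta.mu_nat[OF g] by simp
  also have "\<dots> = pm f g \<odot>\<^bsub>X\<^esub> mu ?a x"
    using X.comp_assoc[OF Ta.mu_hom[OF o(3)] Mg t] pm_eq[OF f g] by simp
  finally show "mu H (Cod AX h) \<odot>\<^bsub>AX\<^esub> MA H (MA H h) = MA H h \<odot>\<^bsub>AX\<^esub> mu H (Dom AX h)"
    unfolding dc by (simp add: h)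
qed

end

sublocale param_monad \<subseteq> hat: monad_on "prod_cat A X" "hat A X T"
proof -
  interpret category "prod_cat A X" by (rule prod_category) unfold_locales
  show "monad_on (prod_cat A X) (hat A X T)" by unfold_locales (rule hat_monad)
qed

section \<open>The semidirect product and its fibres\<close>

context param_monad
begin

lemma semiprod_Obj: "(a, x, \<xi>) \<in> Obj S \<longleftrightarrow> a \<in> Obj A \<and> (x, \<xi>) \<in> Obj (EM X (FO T a))"
  by (simp add: semiprod_def)

lemma semiprod_Arr: "((a, x, \<xi>), (b, y, \<theta>), (f, g)) \<in> Arr S \<longleftrightarrow>
    (a, x, \<xi>) \<in> Obj S \<and> (b, y, \<theta>) \<in> Obj S \<and> f \<in> hom A a b \<and> g \<in> hom X x y \<and>
    g \<odot>\<^bsub>X\<^esub> \<xi> = \<theta> \<odot>\<^bsub>X\<^esub> pm f g"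
  by (simp add: semiprod_def)

lemma semiprod_simps [simp]:
  "Dom S (p, q, fg) = p" "Cod S (p, q, fg) = q"
  "Ident S (a, x, \<xi>) = ((a, x, \<xi>), (a, x, \<xi>), (Ident A a, Ident X x))"
  "(p', q', (f', g')) \<odot>\<^bsub>S\<^esub> (p, q, (f, g)) = (p, q', (f' \<odot>\<^bsub>A\<^esub> f, g' \<odot>\<^bsub>X\<^esub> g))"
  by (simp_all add: semiprod_def)

lemma semiprod_homE:
  assumes "h \<in> hom S (a, x, \<xi>) (b, y, \<theta>)"
  obtains f g where "h = ((a, x, \<xi>), (b, y, \<theta>), (f, g))"
    "(a, x, \<xi>) \<in> Obj S" "(b, y, \<theta>) \<in> Obj S" "f \<in> hom A a b" "g \<in> hom X x y"
    "g \<odot>\<^bsub>X\<^esub> \<xi> = \<theta> \<odot>\<^bsub>X\<^esub> pm f g"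
proof -
  obtain p q f g where h: "h = (p, q, (f, g))" by (metis surj_pair)
  then have "h = ((a, x, \<xi>), (b, y, \<theta>), (f, g))" using homD(2,3)[OF assms] by simp
  then show ?thesis using that homD(1)[OF assms] by (simp add: semiprod_Arr)
qed

lemma semiprod_homI:
  assumes "(a, x, \<xi>) \<in> Obj S" "(b, y, \<theta>) \<in> Obj S" "f \<in> hom A a b" "g \<in> hom X x y"
    "g \<odot>\<^bsub>X\<^esub> \<xi> = \<theta> \<odot>\<^bsub>X\<^esub> pm f g"
  shows "((a, x, \<xi>), (b, y, \<theta>), (f, g)) \<in> hom S (a, x, \<xi>) (b, y, \<theta>)"
  using assms by (intro homI) (simp_all add: semiprod_Arr)

lemma semiprod_Obj_carrier: "(a, x, \<xi>) \<in> Obj S \<Longrightarrow> a \<in> Obj A"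
  "(a, x, \<xi>) \<in> Obj S \<Longrightarrow> x \<in> Obj X" "(a, x, \<xi>) \<in> Obj S \<Longrightarrow> \<xi> \<in> hom X (MO (FO T a) x) x"
  by (simp_all add: semiprod_Obj EM_Obj)

lemma semiprod_category: "category S"
proof
  fix h assume "h \<in> Arr S"
  moreover obtain a x \<xi> b y \<theta> f g where "h = ((a, x, \<xi>), (b, y, \<theta>), (f, g))" by (metis surj_pair)
  ultimately show "Dom S h \<in> Obj S" "Cod S h \<in> Obj S" by (simp_all add: semiprod_Arr)
next
  fix p assume p: "p \<in> Obj S"
  obtain a x \<xi> where [simp]: "p = (a, x, \<xi>)" by (cases p)
  have o: "a \<in> Obj A" "x \<in> Obj X" "\<xi> \<in> hom X (MO (FO T a) x) x"
    using semiprod_Obj_carrier[of a x \<xi>] p by simp_all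
  have "Ident X x \<odot>\<^bsub>X\<^esub> \<xi> = \<xi> \<odot>\<^bsub>X\<^esub> pm (Ident A a) (Ident X x)"
    using o X.ident_comp X.comp_ident pm_Ident_total[OF A.ident_in_hom] tr_Ident by simp
  then show "Ident S p \<in> hom S p p"
    using p o A.ident_in_hom X.ident_in_hom by (auto intro!: semiprod_homI)
next
  fix h k p q r assume h: "h \<in> hom S p q" and k: "k \<in> hom S q r"
  obtain a x \<xi> b y \<theta> c z \<zeta> where [simp]: "p = (a, x, \<xi>)" "q = (b, y, \<theta>)" "r = (c, z, \<zeta>)"
    by (metis surj_pair)
  obtain f g where h': "h = (p, q, (f, g))" "p \<in> Obj S" "q \<in> Obj S" "f \<in> hom A a b" "g \<in> hom X x y"
    "g \<odot>\<^bsub>X\<^esub> \<xi> = \<theta> \<odot>\<^bsub>X\<^esub> pm f g" using h by (auto elim: semiprod_homE)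
  obtain f' g' where k': "k = (q, r, (f', g'))" "r \<in> Obj S" "f' \<in> hom A b c" "g' \<in> hom X y z"
    "g' \<odot>\<^bsub>X\<^esub> \<theta> = \<zeta> \<odot>\<^bsub>X\<^esub> pm f' g'" using k by (auto elim: semiprod_homE)
  have s: "\<xi> \<in> hom X (MO (FO T a) x) x" "\<theta> \<in> hom X (MO (FO T b) y) y"
    "\<zeta> \<in> hom X (MO (FO T c) z) z" using semiprod_Obj_carrier(3) h' k' by auto
  note pf = pm_hom[OF h'(4,5)] and pk = pm_hom[OF k'(3,4)]
  have "(g' \<odot>\<^bsub>X\<^esub> g) \<odot>\<^bsub>X\<^esub> \<xi> = (g' \<odot>\<^bsub>X\<^esub> \<theta>) \<odot>\<^bsub>X\<^esub> pm f g"
    using X.comp_assoc[OF s(1) h'(5) k'(4)] X.comp_assoc[OF pf s(2) k'(4)] h'(6) by simp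
  also have "\<dots> = \<zeta> \<odot>\<^bsub>X\<^esub> pm (f' \<odot>\<^bsub>A\<^esub> f) (g' \<odot>\<^bsub>X\<^esub> g)"
    using X.comp_assoc[OF pf pk s(3)] k'(5) pm_comp[OF h'(4) k'(3) h'(5) k'(4)] by simp
  finally show "k \<odot>\<^bsub>S\<^esub> h \<in> hom S p r"
    using h' k' A.comp_in_hom[OF h'(4) k'(3)] X.comp_in_hom[OF h'(5) k'(4)]
    by (auto intro!: semiprod_homI)
next
  fix h p q assume h: "h \<in> hom S p q"
  obtain a x \<xi> b y \<theta> where [simp]: "p = (a, x, \<xi>)" "q = (b, y, \<theta>)" by (metis surj_pair)
  obtain f g where "h = (p, q, (f, g))" "f \<in> hom A a b" "g \<in> hom X x y"
    using h by (auto elim: semiprod_homE)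
  then show "h \<odot>\<^bsub>S\<^esub> Ident S p = h" "Ident S q \<odot>\<^bsub>S\<^esub> h = h"
    by (simp_all add: A.comp_ident A.ident_comp X.comp_ident X.ident_comp)
next
  fix h k l p q r s assume h: "h \<in> hom S p q" and k: "k \<in> hom S q r" and l: "l \<in> hom S r s"
  obtain a x \<xi> b y \<theta> c z \<zeta> d w \<omega>
    where [simp]: "p = (a, x, \<xi>)" "q = (b, y, \<theta>)" "r = (c, z, \<zeta>)" "s = (d, w, \<omega>)"
    by (metis surj_pair)
  obtain f g where "h = (p, q, (f, g))" "f \<in> hom A a b" "g \<in> hom X x y"
    using h by (auto elim: semiprod_homE)
  moreover obtain f' g' where "k = (q, r, (f', g'))" "f' \<in> hom A b c" "g' \<in> hom X y z"
    using k by (auto elim: semiprod_homE)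
  moreover obtain f'' g'' where "l = (r, s, (f'', g''))" "f'' \<in> hom A c d" "g'' \<in> hom X z w"
    using l by (auto elim: semiprod_homE)
  ultimately show "(l \<odot>\<^bsub>S\<^esub> k) \<odot>\<^bsub>S\<^esub> h = l \<odot>\<^bsub>S\<^esub> (k \<odot>\<^bsub>S\<^esub> h)"
    by (simp add: A.comp_assoc X.comp_assoc)
qed

sublocale S: category S by (rule semiprod_category)

lemma to_EM_hat_simps [simp]:
  "FO (to_EM_hat A) (a, x, \<xi>) = ((a, x), (Ident A a, \<xi>))"
  "FA (to_EM_hat A) (p, q, fg) = (FO (to_EM_hat A) p, FO (to_EM_hat A) q, fg)"
  by (simp_all add: to_EM_hat_def Let_def)

text \<open>
  The first component of the unit of \<open>H\<close> is an identity, so the unit law for an algebra makes the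
  first component of its structure map an identity too.
\<close>
lemma hat_algebra_iff:
  "((a, x), (f, \<xi>)) \<in> Obj (EM AX H) \<longleftrightarrow> f = Ident A a \<and> (a, x, \<xi>) \<in> Obj S"
proof (cases "a \<in> Obj A \<and> f = Ident A a \<and> \<xi> \<in> hom X (MO (FO T a) x) x")
  case True
  then have a: "a \<in> Obj A" and f: "f = Ident A a" and \<xi>: "\<xi> \<in> hom X (MO (FO T a) x) x" by auto
  show ?thesis
    using a \<xi> A.ident_in_hom[OF a] A.comp_ident[OF A.ident_in_hom[OF a]]
    by (simp add: EM_Obj semiprod_Obj f pm_Ident_base[OF a \<xi>])
next
  case False
  moreover have "f = Ident A a" if "f \<odot>\<^bsub>A\<^esub> Ident A a = Ident A a" "f \<in> hom A a a"
    using that A.comp_ident by simp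
  ultimately show ?thesis by (auto simp: EM_Obj semiprod_Obj)
qed

lemma hat_arrow_iff:
  "(FO (to_EM_hat A) p, FO (to_EM_hat A) q, fg) \<in> Arr (EM AX H) \<longleftrightarrow> (p, q, fg) \<in> Arr S"
proof -
  obtain a x \<xi> b y \<theta> f g where [simp]: "p = (a, x, \<xi>)" "q = (b, y, \<theta>)" "fg = (f, g)"
    by (metis surj_pair)
  show ?thesis
    using A.comp_ident[of f a b] A.ident_comp[of f a b]
    by (auto simp: EM_Arr hat_algebra_iff semiprod_Arr)
qed

lemma to_EM_hat_iso: "iso_functor S (EM AX H) (to_EM_hat A)"
  unfolding iso_functor_def
proof (intro conjI)
  let ?K = "to_EM_hat A" and ?E = "EM AX H"
  have obj: "FO ?K p \<in> Obj ?E \<longleftrightarrow> p \<in> Obj S" for p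
    by (cases p) (simp add: hat_algebra_iff)
  have K_inj: "FO ?K p = FO ?K q \<Longrightarrow> p = q" for p q
    by (cases p; cases q) simp
  have obj_lift: "\<exists>p\<in>Obj S. FO ?K p = P" if "P \<in> Obj ?E" for P
  proof -
    obtain a x f \<xi> where P: "P = ((a, x), (f, \<xi>))" by (metis surj_pair)
    have "f = Ident A a" "(a, x, \<xi>) \<in> Obj S" using that by (simp_all add: P hat_algebra_iff)
    then show ?thesis using P by (intro bexI[of _ "(a, x, \<xi>)"]) simp_all
  qed
  show "bij_betw (FO ?K) (Obj S) (Obj ?E)"
    unfolding bij_betw_def
  proof
    show "inj_on (FO ?K) (Obj S)" by (intro inj_onI) (rule K_inj)
    show "FO ?K ` Obj S = Obj ?E" using obj obj_lift by blast
  qed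
  have arr_lift: "\<exists>h\<in>Arr S. FA ?K h = h'" if h': "h' \<in> Arr ?E" for h'
  proof -
    obtain P Q fg where h: "h' = (P, Q, fg)" by (metis surj_pair)
    have "P \<in> Obj ?E" "Q \<in> Obj ?E"
      using hat.EM.dom_in_Obj[OF h'] hat.EM.cod_in_Obj[OF h'] by (simp_all add: h)
    then obtain p q where pq: "FO ?K p = P" "FO ?K q = Q" using obj_lift by blast
    have "(p, q, fg) \<in> Arr S" using h' hat_arrow_iff[of p q fg] by (simp only: h pq)
    then show ?thesis using h pq by (intro bexI[of _ "(p, q, fg)"]) simp_all
  qed
  have arr: "FA ?K h \<in> Arr ?E \<longleftrightarrow> h \<in> Arr S" for h
    by (cases h) (simp add: hat_arrow_iff del: to_EM_hat_simps(1))
  show "bij_betw (FA ?K) (Arr S) (Arr ?E)"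
    unfolding bij_betw_def
  proof
    show "inj_on (FA ?K) (Arr S)"
    proof (rule inj_onI)
      fix h h' assume eq: "FA ?K h = FA ?K h'"
      obtain p q fg where h: "h = (p, q, fg)" by (cases h)
      obtain p' q' fg' where h': "h' = (p', q', fg')" by (cases h')
      have "FO ?K p = FO ?K p'" "FO ?K q = FO ?K q'" "fg = fg'" using eq by (simp_all add: h h')
      then show "h = h'" using K_inj[of p p'] K_inj[of q q'] h h' by blast
    qed
    show "FA ?K ` Arr S = Arr ?E" using arr arr_lift by blast
  qed
  show "is_functor S ?E ?K"
    unfolding is_functor_def
  proof (intro conjI ballI impI)
    show "category S" "category ?E" by unfold_locales
    show "FO ?K p \<in> Obj ?E" if "p \<in> Obj S" for p using that obj by simp
    show "FA ?K (Ident S p) = Ident ?E (FO ?K p)" for p by (cases p) simp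
    fix h assume h: "h \<in> Arr S"
    show "FA ?K h \<in> hom ?E (FO ?K (Dom S h)) (FO ?K (Cod S h))"
      using h by (cases h) (auto simp: hom_def hat_arrow_iff simp del: to_EM_hat_simps(1))
    fix k
    show "FA ?K (k \<odot>\<^bsub>S\<^esub> h) = FA ?K k \<odot>\<^bsub>?E\<^esub> FA ?K h"
      by (cases h; cases k) (auto simp del: to_EM_hat_simps(1))
  qed
qed

lemma fibre_incl_simps [simp]:
  "FO (fibre_incl A a) p = (a, p)"
  "FA (fibre_incl A a) (p, q, g) = ((a, p), (a, q), (Ident A a, g))"
  by (cases p; simp add: fibre_incl_def)+

lemma semiprod_proj_simps [simp]:
  "FO semiprod_proj (a, x, \<xi>) = a" "FA semiprod_proj (p, q, (f, g)) = f"
  by (simp_all add: semiprod_proj_def)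

text \<open>
  By associativity, \<open>\<theta> \<odot> pm u g = (\<theta> \<odot> tr u y) \<odot> MA (FO T a) g\<close>: compatibility with structure maps
  over \<open>u\<close> is the same as being an algebra morphism over \<open>a\<close> into the reindexed algebra.
\<close>
lemma semiprod_arrow_reindex:
  assumes u: "u \<in> hom A a b" and y: "(b, y, \<theta>) \<in> Obj S"
  shows "((a, x, \<xi>), (b, y, \<theta>), (u, g)) \<in> Arr S
    \<longleftrightarrow> ((x, \<xi>), (y, \<theta> \<odot>\<^bsub>X\<^esub> tr u y), g) \<in> Arr (EM X (FO T a))"
proof -
  have o: "a \<in> Obj A" "y \<in> Obj X" "\<theta> \<in> hom X (MO (FO T b) y) y" and
    alg: "(y, \<theta>) \<in> Obj (EM X (FO T b))"
    using A.hom_Obj[OF u] y semiprod_Obj_carrier(2,3)[OF y] by (simp_all add: semiprod_Obj)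
  note r = monad_morphism_restrict[OF tr_morphism[OF u] alg]
  have "\<theta> \<odot>\<^bsub>X\<^esub> pm u g = (\<theta> \<odot>\<^bsub>X\<^esub> tr u y) \<odot>\<^bsub>X\<^esub> MA (FO T a) g" if "g \<in> hom X x y"
    using X.comp_assoc[OF MA_T_hom[OF o(1) that] tr_hom[OF u o(2)] o(3)]
    by (simp add: pm_eq[OF u that])
  then show ?thesis using u y r o(1) by (auto simp: semiprod_Arr EM_Arr semiprod_Obj)
qed

lemma fibre_arrow_iff:
  assumes a: "a \<in> Obj A"
  shows "((a, p), (a, q), (Ident A a, g)) \<in> Arr S \<longleftrightarrow> (p, q, g) \<in> Arr (EM X (FO T a))"
proof -
  obtain x \<xi> y \<theta> where [simp]: "p = (x, \<xi>)" "q = (y, \<theta>)" by (metis surj_pair)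
  have "pm (Ident A a) g = MA (FO T a) g" if "g \<in> hom X x y" by (rule pm_Ident_base[OF a that])
  then show ?thesis using a A.ident_in_hom[OF a] by (auto simp: semiprod_Arr EM_Arr semiprod_Obj)
qed

lemma semiprod_proj_functor: "is_functor S A semiprod_proj"
  unfolding is_functor_def
proof (intro conjI ballI impI)
  let ?P = "semiprod_proj"
  show "category S" "category A" by unfold_locales
  show "FO ?P p \<in> Obj A" if "p \<in> Obj S" for p
    using that by (cases p) (simp add: semiprod_Obj)
  show "FA ?P (Ident S p) = Ident A (FO ?P p)" for p :: "'a \<times> 'x \<times> 'g"
    by (cases p) simp
  fix h assume h: "h \<in> Arr S"
  obtain a x \<xi> b y \<theta> f g where hh: "h = ((a, x, \<xi>), (b, y, \<theta>), (f, g))" by (metis surj_pair)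
  show "FA ?P h \<in> hom A (FO ?P (Dom S h)) (FO ?P (Cod S h))"
    using h by (simp add: hh semiprod_Arr)
  fix k
  show "FA ?P (k \<odot>\<^bsub>S\<^esub> h) = FA ?P k \<odot>\<^bsub>A\<^esub> FA ?P h"
    by (cases h; cases k) auto
qed

lemma fibre_incl_functor:
  assumes a: "a \<in> Obj A"
  shows "is_functor (EM X (FO T a)) S (fibre_incl A a)"
  unfolding is_functor_def
proof (intro conjI ballI impI)
  interpret Ta: monad_on X "FO T a" by (rule fibre_monad[OF a])
  let ?J = "fibre_incl A a" and ?E = "EM X (FO T a)"
  show "category ?E" "category S" by unfold_locales
  show "FO ?J p \<in> Obj S" if "p \<in> Obj ?E" for p
    using that a by (cases p) (simp add: semiprod_Obj)
  show "FA ?J (Ident ?E p) = Ident S (FO ?J p)" for p by (cases p) simp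
  fix h assume h: "h \<in> Arr ?E"
  show "FA ?J h \<in> hom S (FO ?J (Dom ?E h)) (FO ?J (Cod ?E h))"
    using h by (cases h) (auto simp: hom_def fibre_arrow_iff[OF a])
  fix k
  show "FA ?J (k \<odot>\<^bsub>?E\<^esub> h) = FA ?J k \<odot>\<^bsub>S\<^esub> FA ?J h"
    using A.comp_ident[OF A.ident_in_hom[OF a]] by (cases h; cases k) auto
qed

text \<open>
  The precartesian arrow has an identity as underlying arrow of \<open>X\<close>, so composing with it
  changes only the base component.
\<close>
lemma reindexing_precartesian:
  assumes u: "u \<in> hom A a b" and y: "(b, y, \<theta>) \<in> Obj S"
  shows "precartesian S (EM X (FO T a)) semiprod_proj (fibre_incl A a) (y, \<theta> \<odot>\<^bsub>X\<^esub> tr u y)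
    ((a, y, \<theta> \<odot>\<^bsub>X\<^esub> tr u y), (b, y, \<theta>), (u, Ident X y)) (b, y, \<theta>)"
proof -
  let ?E = "EM X (FO T a)" and ?r = "(y, \<theta> \<odot>\<^bsub>X\<^esub> tr u y)"
  let ?d = "((a, ?r), (b, y, \<theta>), (u, Ident X y))"
  have a: "a \<in> Obj A" and alg: "(y, \<theta>) \<in> Obj (EM X (FO T b))"
    using A.hom_Obj[OF u] y by (simp_all add: semiprod_Obj)
  interpret Ta: monad_on X "FO T a" by (rule fibre_monad[OF a])
  note r = monad_morphism_restrict[OF tr_morphism[OF u] alg]
  have d: "?d \<in> hom S (a, ?r) (b, y, \<theta>)"
    using Ta.EM.Ident_Arr(1)[OF r] by (intro homI) (simp_all add: semiprod_arrow_reindex[OF u y])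
  show ?thesis
    unfolding precartesian_def
  proof (intro conjI ballI impI)
    show "?r \<in> Obj ?E" by (rule r)
    show "?d \<in> hom S (FO (fibre_incl A a) ?r) (b, y, \<theta>)" using d by simp
    fix p h assume p: "p \<in> Obj ?E" and h: "h \<in> hom S (FO (fibre_incl A a) p) (b, y, \<theta>)"
      and u': "FA semiprod_proj h = FA semiprod_proj ?d"
    obtain x \<xi> where [simp]: "p = (x, \<xi>)" by (cases p)
    obtain g where hh: "h = ((a, x, \<xi>), (b, y, \<theta>), (u, g))" and g: "g \<in> hom X x y"
      using h u' by (auto elim!: semiprod_homE)
    have comp: "?d \<odot>\<^bsub>S\<^esub> FA (fibre_incl A a) (p, ?r, g') = ((a, x, \<xi>), (b, y, \<theta>), (u, g'))"
      if "g' \<in> hom X x y" for g'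
      using A.comp_ident[OF u] X.ident_comp[OF that] by simp
    have "(p, ?r, g) \<in> Arr ?E"
      using homD(1)[OF h] by (simp add: hh semiprod_arrow_reindex[OF u y])
    then have 0: "(p, ?r, g) \<in> hom ?E p ?r" by (intro homI) simp_all
    show "\<exists>!h\<^sub>0. h\<^sub>0 \<in> hom ?E p ?r \<and> ?d \<odot>\<^bsub>S\<^esub> FA (fibre_incl A a) h\<^sub>0 = h"
    proof (rule ex1I[of _ "(p, ?r, g)"])
      show "(p, ?r, g) \<in> hom ?E p ?r \<and> ?d \<odot>\<^bsub>S\<^esub> FA (fibre_incl A a) (p, ?r, g) = h"
        using 0 comp[OF g] hh by simp
      fix k assume k: "k \<in> hom ?E p ?r \<and> ?d \<odot>\<^bsub>S\<^esub> FA (fibre_incl A a) k = h"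
      then obtain g' where "k = (p, ?r, g')" "g' \<in> hom X x y" by (auto elim: EM_homE)
      then show "k = (p, ?r, g)" using k comp hh by simp
    qed
  qed
qed

lemma fibre_of_semiprod:
  assumes a: "a \<in> Obj A"
  shows "fibre_of S (EM X (FO T a)) A semiprod_proj (fibre_incl A a) a"
proof -
  interpret Ta: monad_on X "FO T a" by (rule fibre_monad[OF a])
  let ?J = "fibre_incl A a" and ?E = "EM X (FO T a)"
  show ?thesis
  proof
    show "is_functor S A semiprod_proj" by (rule semiprod_proj_functor)
    show "is_functor ?E S ?J" by (rule fibre_incl_functor[OF a])
    show "a \<in> Obj A" by (rule a)
    show "FA semiprod_proj (FA ?J f) = Ident A a" for f by (cases f) simp
    show "f = g" if "f \<in> hom ?E x y" "g \<in> hom ?E x y" "FA ?J f = FA ?J g" for f g x y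
      using that by (cases f; cases g) simp
    show "\<exists>h\<^sub>0\<in>hom ?E x y. FA ?J h\<^sub>0 = h"
      if "x \<in> Obj ?E" "y \<in> Obj ?E" and h: "h \<in> hom S (FO ?J x) (FO ?J y)"
        and v: "FA semiprod_proj h = Ident A a" for x y h
    proof -
      obtain p q f g where hh: "h = (p, q, (f, g))" by (metis surj_pair)
      have eq: "h = ((a, x), (a, y), (Ident A a, g))" using homD(2,3)[OF h] v hh by simp
      have "(x, y, g) \<in> hom ?E x y"
        using homD(1)[OF h] by (intro homI) (simp_all add: eq fibre_arrow_iff[OF a])
      then show ?thesis using eq by (intro bexI[of _ "(x, y, g)"]) simp_all
    qed
    show "\<exists>r d. precartesian S ?E semiprod_proj ?J r d z \<and> FA semiprod_proj d = u"
      if "z \<in> Obj S" "u \<in> hom A a (FO semiprod_proj z)" for z u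
    proof -
      obtain b y \<theta> where z: "z = (b, y, \<theta>)" by (cases z)
      have "precartesian S ?E semiprod_proj ?J (y, \<theta> \<odot>\<^bsub>X\<^esub> tr u y)
          ((a, y, \<theta> \<odot>\<^bsub>X\<^esub> tr u y), (b, y, \<theta>), (u, Ident X y)) z"
        using reindexing_precartesian[of u a b y \<theta>] that by (simp add: z)
      then show ?thesis by force
    qed
  qed
qed

text \<open>
  The hypotheses \<open>i\<close> and \<open>j\<close> say that, along each coprojection, \<open>h\<close> restricts to an arrow
  whose base component is that coprojection; the arrows with base components \<open>Ident A a\<close> and
  \<open>Ident A b\<close> are to be instantiated by the canonical pairs of two algebras. So the base
  component of \<open>h\<close> fixes both coprojections and is an identity.
\<close>
lemma vertical_of_coprojections:
  assumes c: "is_coproduct A a b (s, i, j)"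
    and h: "h \<in> hom (EM AX H) (FO (free AX H) (s, t')) (FO (free AX H) (s, t))"
    and t: "t \<in> Obj X" "t' \<in> Obj X"
    and i: "h \<odot>\<^bsub>EM AX H\<^esub> FA (free AX H) (i, i\<^sub>1)
      = FA (free AX H) (i, i\<^sub>2) \<odot>\<^bsub>EM AX H\<^esub> (p, q, (Ident A a, u))"
    and j: "h \<odot>\<^bsub>EM AX H\<^esub> FA (free AX H) (j, j\<^sub>1)
      = FA (free AX H) (j, j\<^sub>2) \<odot>\<^bsub>EM AX H\<^esub> (p', q', (Ident A b, v))"
  defines "\<Phi> \<equiv> \<lambda>x. (MO (FO T s) x, mu (FO T s) x)"
  shows "\<exists>h\<^sub>0\<in>hom (EM X (FO T s)) (\<Phi> t') (\<Phi> t).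
    FA (to_EM_hat A) (FA (fibre_incl A s) h\<^sub>0) = h"
proof -
  let ?K = "to_EM_hat A" and ?J = "fibre_incl A s"
  note ij = A.coproduct_homs[OF c]
  have s: "s \<in> Obj A" using A.hom_Obj[OF ij(1)] by simp
  interpret Ts: monad_on X "FO T s" by (rule fibre_monad[OF s])
  interpret K: category_iso S "EM AX H" ?K by unfold_locales (rule to_EM_hat_iso)
  interpret F: fibre_of S "EM X (FO T s)" A semiprod_proj ?J s by (rule fibre_of_semiprod[OF s])
  have \<Phi>: "\<Phi> x \<in> Obj (EM X (FO T s))" if "x \<in> Obj X" for x
    using Ts.free_Obj[OF that] by (simp add: \<Phi>_def)
  have free: "FO (free AX H) (s, x) = FO ?K (FO ?J (\<Phi> x))" for x
    by (simp add: free_def \<Phi>_def)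
  have o: "FO ?J (\<Phi> t') \<in> Obj S" "FO ?J (\<Phi> t) \<in> Obj S"
    using functor_Obj[OF F.J] \<Phi> t by blast+
  obtain e where e: "e \<in> hom S (FO ?J (\<Phi> t')) (FO ?J (\<Phi> t))" "FA ?K e = h"
    by (rule K.hom_lift[OF h[unfolded free] o])
  obtain f g where fg: "e = (FO ?J (\<Phi> t'), FO ?J (\<Phi> t), (f, g))" and f: "f \<in> hom A s s"
    using e(1) by (auto simp: \<Phi>_def elim: semiprod_homE)
  have "f \<odot>\<^bsub>A\<^esub> i = i \<odot>\<^bsub>A\<^esub> Ident A a" "f \<odot>\<^bsub>A\<^esub> j = j \<odot>\<^bsub>A\<^esub> Ident A b"
    using i j by (simp_all add: e(2)[symmetric] fg free_def)
  then have "f = Ident A s"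
    using A.comp_ident ij A.ident_comp
    by (intro A.coproduct_ext[OF c f A.ident_in_hom[OF s]]) simp_all
  then have "FA semiprod_proj e = Ident A s" by (simp add: fg)
  then obtain h\<^sub>0 where "h\<^sub>0 \<in> hom (EM X (FO T s)) (\<Phi> t') (\<Phi> t)" "FA ?J h\<^sub>0 = e"
    using F.vertical_lift[OF \<Phi>[OF t(2)] \<Phi>[OF t(1)] e(1)] by blast
  then show ?thesis using e(2) by blast
qed

end

section \<open>Binary coproducts in the semidirect product\<close>

theorem proposition4p8:
  fixes \<A> :: "('a, 'f) cat" and \<X> :: "('x, 'g) cat"
    and T :: "('a, 'f, 'x, 'g) pmonad"
    and A B AB :: 'a and iA iB :: 'f
    and X Y XY TXY :: 'x and \<xi> \<theta> iX iY jX jY :: 'g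
  assumes "infinite (UNIV :: 'u set)"
    and "cocomplete TYPE('u) \<A>" and "cocomplete TYPE('u) \<X>"
    and "parametrized_monad \<A> \<X> T"
    and "(A, X, \<xi>) \<in> Obj (semiprod \<A> \<X> T)" and "(B, Y, \<theta>) \<in> Obj (semiprod \<A> \<X> T)"
    and "is_coproduct \<A> A B (AB, iA, iB)"
    and "is_coproduct \<X> X Y (XY, iX, iY)"
    and "is_coproduct \<X> (MO (FO T A) X) (MO (FO T B) Y) (TXY, jX, jY)"
  defines "S \<equiv> semiprod \<A> \<X> T"
    and "P \<equiv> semiprod_proj :: (('a, 'x, 'g) pobj, ('a, 'f, 'x, 'g) parr, 'a, 'f) fctr"
    and "K \<equiv> to_EM_hat \<A>"
    and "C \<equiv> prod_cat \<A> \<X>"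
    and "That \<equiv> hat \<A> \<X> T"
    and "E \<equiv> EM \<X> (FO T AB)"
    and "J \<equiv> fibre_incl \<A> AB"
    and "k \<equiv> pair_cospan (AB, iA, iB) (XY, iX, iY)"
    and "l \<equiv> pair_cospan (AB, iA, iB) (TXY, jX, jY)"
    and "a \<equiv> (A, X, \<xi>)" and "b \<equiv> (B, Y, \<theta>)"
  shows "is_monad C That \<and> iso_functor S (EM C That) K \<and>
    (\<exists>f g. FA K f = linton_fst C That k l (FO K a) (FO K b) \<and>
       FA K g = linton_snd C That k l (FO K a) (FO K b) \<and>
       reflexive_pair S f g \<and>
       FO P (Dom S f) = AB \<and> FO P (Cod S f) = AB \<and>
       FA P f = Ident \<A> AB \<and> FA P g = Ident \<A> AB \<and>
       (\<exists>f\<^sub>0 g\<^sub>0. reflexive_pair E f\<^sub>0 g\<^sub>0 \<and> FA J f\<^sub>0 = f \<and> FA J g\<^sub>0 = g \<and>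
          (\<forall>c q. is_coequaliser E f\<^sub>0 g\<^sub>0 c q \<longrightarrow>
             is_coequaliser S f g (FO J c) (FA J q) \<and>
             (\<exists>m n. is_coproduct S a b (FO J c, m, n) \<and>
                FA K m \<odot>\<^bsub>EM C That\<^esub> counit C That (FO K a)
                  = FA K (FA J q) \<odot>\<^bsub>EM C That\<^esub> FA (free C That) (fst (snd k)) \<and>
                FA K n \<odot>\<^bsub>EM C That\<^esub> counit C That (FO K b)
                  = FA K (FA J q) \<odot>\<^bsub>EM C That\<^esub> FA (free C That) (snd (snd k)))) \<and>
          ((\<exists>c q. is_coequaliser S f g c q) \<longrightarrow> (\<exists>c q. is_coequaliser E f\<^sub>0 g\<^sub>0 c q))))"
proof -
  have "category \<A>" "category \<X>" using assms(2,3) by (simp_all add: cocomplete_def)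
  then interpret A: category \<A> + X: category \<X> .
  interpret param_monad \<A> \<X> T by unfold_locales (rule assms(4))
  have AB: "AB \<in> Obj \<A>" using A.hom_Obj[OF A.coproduct_homs(1)[OF assms(7)]] by simp
  interpret K: category_iso S "EM C That" K
    unfolding S_def C_def That_def K_def by unfold_locales (rule to_EM_hat_iso)
  interpret F: fibre_of S E \<A> P J AB
    unfolding S_def E_def P_def J_def by (rule fibre_of_semiprod[OF AB])
  have a: "a \<in> Obj S" and b: "b \<in> Obj S" using assms(5,6) by (simp_all add: a_def b_def S_def)
  have k: "is_coproduct C (A, X) (B, Y) k"
    unfolding C_def k_def by (rule pair_coproduct[OF A.category_axioms X.category_axioms assms(7,8)])
  have "is_coproduct C (A, MO (FO T A) X) (B, MO (FO T B) Y) l"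
    unfolding C_def l_def by (rule pair_coproduct[OF A.category_axioms X.category_axioms assms(7,9)])
  then have l: "is_coproduct C (MO That (A, X)) (MO That (B, Y)) l" by (simp add: That_def)
  have Ka: "FO K a = ((A, X), (Ident \<A> A, \<xi>))" and Kb: "FO K b = ((B, Y), (Ident \<A> B, \<theta>))"
    by (simp_all add: K_def a_def b_def)
  have KaE: "((A, X), (Ident \<A> A, \<xi>)) \<in> Obj (EM C That)"
    and KbE: "((B, Y), (Ident \<A> B, \<theta>)) \<in> Obj (EM C That)"
    using functor_Obj[OF K.F a] functor_Obj[OF K.F b] Ka Kb by simp_all
  let ?L = "linton_fst C That k l (FO K a) (FO K b)"
  let ?R = "linton_snd C That k l (FO K a) (FO K b)"
  let ?\<Phi> = "\<lambda>x. (MO (FO T AB) x, mu (FO T AB) x)"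
  have t: "XY \<in> Obj \<X>" "TXY \<in> Obj \<X>"
    using X.hom_Obj[OF X.coproduct_homs(1)[OF assms(8)]] X.hom_Obj[OF X.coproduct_homs(1)[OF assms(9)]]
    by simp_all
  note diag = KaE[unfolded C_def That_def] KbE[unfolded C_def That_def]
    k[unfolded C_def] l[unfolded C_def That_def]
  have cs: "fst (snd k) = (iA, iX)" "snd (snd k) = (iB, iY)" "fst k = (AB, XY)"
    "fst (snd l) = (iA, jX)" "snd (snd l) = (iB, jY)" "fst l = (AB, TXY)"
    by (simp_all add: k_def l_def pair_cospan_def)
  note homs = hat.linton_homs[OF diag, unfolded cs]
  note coprojections = hat.linton_coprojections[OF diag, unfolded cs]
  \<comment> \<open>The base components on the two summands are \<open>Ident \<A> A\<close> and \<open>Ident \<A> B\<close>, being those of multiplications.\<close>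
  have "\<exists>f\<^sub>0\<in>hom E (?\<Phi> TXY) (?\<Phi> XY). FA K (FA J f\<^sub>0) = ?L"
    unfolding E_def K_def J_def C_def That_def Ka[unfolded K_def] Kb[unfolded K_def]
    by (rule vertical_of_coprojections[OF assms(7) homs(1) t
          coprojections(1)[unfolded counit_def, simplified]
          coprojections(2)[unfolded counit_def, simplified]])
  then obtain f\<^sub>0 where f0: "f\<^sub>0 \<in> hom E (?\<Phi> TXY) (?\<Phi> XY)" and Kf: "FA K (FA J f\<^sub>0) = ?L" by blast
  \<comment> \<open>Here they are those of the structure maps of \<open>FO K a\<close> and \<open>FO K b\<close>.\<close>
  have "\<exists>g\<^sub>0\<in>hom E (?\<Phi> TXY) (?\<Phi> XY). FA K (FA J g\<^sub>0) = ?R"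
    unfolding E_def K_def J_def C_def That_def Ka[unfolded K_def] Kb[unfolded K_def]
    by (rule vertical_of_coprojections[OF assms(7) homs(2) t
          coprojections(3)[unfolded hat.free_FA[OF hat.carrier(3)[OF diag]] hat_simps]
          coprojections(4)[unfolded hat.free_FA[OF hat.carrier(4)[OF diag]] hat_simps]])
  then obtain g\<^sub>0 where g0: "g\<^sub>0 \<in> hom E (?\<Phi> TXY) (?\<Phi> XY)" and Kg: "FA K (FA J g\<^sub>0) = ?R" by blast
  note Jf = F.J_hom[OF f0] and Jg = F.J_hom[OF g0]
  have refl: "reflexive_pair S (FA J f\<^sub>0) (FA J g\<^sub>0)"
    using hat.linton_reflexive[OF diag]
    by (intro K.reflexive_pair_reflect[OF Jf Jg]) (simp add: Kf Kg Ka Kb C_def That_def)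
  have coproduct: "\<exists>m n. is_coproduct S a b (FO J c, m, n) \<and>
      FA K m \<odot>\<^bsub>EM C That\<^esub> counit C That (FO K a)
        = FA K (FA J q) \<odot>\<^bsub>EM C That\<^esub> FA (free C That) (fst (snd k)) \<and>
      FA K n \<odot>\<^bsub>EM C That\<^esub> counit C That (FO K b)
        = FA K (FA J q) \<odot>\<^bsub>EM C That\<^esub> FA (free C That) (snd (snd k))"
    if q: "is_coequaliser E f\<^sub>0 g\<^sub>0 c q" for c q
  proof -
    have c: "FO J c \<in> Obj S"
      using functor_Obj[OF F.J] F.E.hom_Obj(2)[OF F.E.coequaliser_hom[OF q f0]] by blast
    have "is_coequaliser (EM C That) ?L ?R (FO K (FO J c)) (FA K (FA J q))"
      using K.coequaliser_preserve[OF F.fibre_coequaliser_preserve[OF q]] by (simp only: Kf Kg)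
    then obtain m' n' where mn: "is_coproduct (EM C That) (FO K a) (FO K b) (FO K (FO J c), m', n')"
      and m': "m' \<odot>\<^bsub>EM C That\<^esub> counit C That (FO K a)
        = FA K (FA J q) \<odot>\<^bsub>EM C That\<^esub> FA (free C That) (fst (snd k))"
      and n': "n' \<odot>\<^bsub>EM C That\<^esub> counit C That (FO K b)
        = FA K (FA J q) \<odot>\<^bsub>EM C That\<^esub> FA (free C That) (snd (snd k))"
      using hat.linton_coproduct[OF diag] unfolding Ka Kb C_def That_def by blast
    obtain m n where "FA K m = m'" "FA K n = n'" "is_coproduct S a b (FO J c, m, n)"
      by (rule K.coproduct_reflect[OF a b c mn])
    then show ?thesis using m' n' by blast
  qed
  have over: "FO P (Dom S (FA J f\<^sub>0)) = AB" "FO P (Cod S (FA J f\<^sub>0)) = AB"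
    using homD[OF Jf] F.J_Obj F.E.hom_Obj[OF f0] by simp_all
  have vert: "FA P (FA J f\<^sub>0) = Ident \<A> AB" "FA P (FA J g\<^sub>0) = Ident \<A> AB"
    using F.J_vertical homD(1)[OF f0] homD(1)[OF g0] by simp_all
  have "is_monad C That" unfolding C_def That_def by (rule hat_monad)
  moreover have "\<exists>f\<^sub>0' g\<^sub>0'. reflexive_pair E f\<^sub>0' g\<^sub>0' \<and> FA J f\<^sub>0' = FA J f\<^sub>0 \<and> FA J g\<^sub>0' = FA J g\<^sub>0 \<and>
      (\<forall>c q. is_coequaliser E f\<^sub>0' g\<^sub>0' c q \<longrightarrow>
         is_coequaliser S (FA J f\<^sub>0) (FA J g\<^sub>0) (FO J c) (FA J q) \<and>
         (\<exists>m n. is_coproduct S a b (FO J c, m, n) \<and>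
            FA K m \<odot>\<^bsub>EM C That\<^esub> counit C That (FO K a)
              = FA K (FA J q) \<odot>\<^bsub>EM C That\<^esub> FA (free C That) (fst (snd k)) \<and>
            FA K n \<odot>\<^bsub>EM C That\<^esub> counit C That (FO K b)
              = FA K (FA J q) \<odot>\<^bsub>EM C That\<^esub> FA (free C That) (snd (snd k)))) \<and>
      ((\<exists>c q. is_coequaliser S (FA J f\<^sub>0) (FA J g\<^sub>0) c q) \<longrightarrow>
         (\<exists>c q. is_coequaliser E f\<^sub>0' g\<^sub>0' c q))"
    using F.fibre_reflexive[OF f0 g0 refl] F.fibre_coequaliser_preserve coproduct
      F.fibre_coequaliser_exists[OF f0 g0]
    by (intro exI[of _ f\<^sub>0] exI[of _ g\<^sub>0] conjI allI impI) auto
  ultimately show ?thesis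
    using K.iso Kf Kg refl over vert
    by (intro conjI exI[of _ "FA J f\<^sub>0"] exI[of _ "FA J g\<^sub>0"]) assumption+
qed

end
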